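(* Let $\lambda\in(0,1)$. For $n\ge2$ let $a_n=\frac{1}{(n+4)\log(n+4)}$ and let $(A_n)_{n\ge2}$, $(B_n)_{n\ge2}$ be sequences of open subintervals of $[0,1]$ with $A_n\cap B_n=\emptyset$, $A_{n+1}\subset A_n$, $B_{n+1}\subset B_n$ and $|A_n|=a_n=\lambda^{-1}|B_n|$ for all $n\ge2$. Let $f_n\equiv1$ on $[0,1]$ for integers $n\le1$, and for $n\ge2$ let $f_n=\lambda$ on $A_n$, $f_n=\lambda^{-1}$ on $B_n$, and $f_n=1$ on $[0,1]\setminus(A_n\cup B_n)$. Let $T$ be the Bernoulli shift on $\big([0,1]^{\mathbb{Z}},\mathcal{B},\bigotimes_{n\in\mathbb{Z}}f_n\big)$. Then $T$ is power weakly mixing: for all $k\ge1$ and all nonzero integers $n_1,\dots,n_k$, the product $T^{n_1}\times T^{n_2}\times\cdots\times T^{n_k}$ is ergodic with respect to the $k$-fold product measure.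
   Context: $|\cdot|$ denotes Lebesgue measure. Each $f_n$ is a probability density on $[0,1]$, identified with the measure $E\mapsto\int_E f_n(u)\,du$. $T$ is the left-shift $(Tx)_i=x_{i+1}$ and $\mathcal{B}$ the product Borel sigma-algebra. An invertible nonsingular map $S$ of $(\Omega,\mathcal{F},\mu)$ is ergodic if every $E\in\mathcal{F}$ with $\mu(E\triangle S^{-1}E)=0$ satisfies $\mu(E)=0$ or $\mu(E^c)=0$. *)

theory Defs
  imports "HOL-Probability.Probability"
begin

definition invertible_nonsingular :: "'a measure \<Rightarrow> ('a \<Rightarrow> 'a) \<Rightarrow> bool" where
  "invertible_nonsingular M S \<longleftrightarrow>
     bij_betw S (space M) (space M) \<and>
     S \<in> measurable M M \<and>
     the_inv_into (space M) S \<in> measurable M M \<and>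
     (\<forall>E\<in>sets M. emeasure M (S -` E \<inter> space M) = 0 \<longleftrightarrow> emeasure M E = 0)"

text \<open>
  Ergodicity is a notion for invertible nonsingular maps only, so this is part of the predicate.
  Invariance is up to null sets.
\<close>

definition ergodic :: "'a measure \<Rightarrow> ('a \<Rightarrow> 'a) \<Rightarrow> bool" where
  "ergodic M S \<longleftrightarrow>
     invertible_nonsingular M S \<and>
     (\<forall>E\<in>sets M.
        emeasure M ((E - (S -` E \<inter> space M)) \<union> ((S -` E \<inter> space M) - E)) = 0 \<longrightarrow>
        emeasure M E = 0 \<or> emeasure M (space M - E) = 0)"

text \<open>Integer iterates of a bijection of \<open>\<Omega>\<close>; the values outside \<open>\<Omega>\<close> are irrelevant.\<close>

definition int_iterate :: "'a set \<Rightarrow> ('a \<Rightarrow> 'a) \<Rightarrow> int \<Rightarrow> 'a \<Rightarrow> 'a" where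
  "int_iterate \<Omega> S n =
     (if 0 \<le> n then S ^^ nat n else the_inv_into \<Omega> S ^^ nat (- n))"

text \<open>
  \<open>S 0 \<times> \<dots> \<times> S (k - 1)\<close>, acting on points of a product \<open>Pi\<^sub>M {..<k} M\<close>, which are
  extensional functions on \<open>{..<k}\<close>.
\<close>

definition product_map :: "nat \<Rightarrow> (nat \<Rightarrow> 'a \<Rightarrow> 'a) \<Rightarrow> (nat \<Rightarrow> 'a) \<Rightarrow> (nat \<Rightarrow> 'a)" where
  "product_map k S = (\<lambda>x. \<lambda>j\<in>{..<k}. S j (x j))"

definition power_weakly_mixing :: "'a measure \<Rightarrow> ('a \<Rightarrow> 'a) \<Rightarrow> bool" where
  "power_weakly_mixing M S \<longleftrightarrow>
     (\<forall>(k::nat) (n::nat \<Rightarrow> int). 1 \<le> k \<longrightarrow> (\<forall>j<k. n j \<noteq> 0) \<longrightarrow>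
        ergodic (Pi\<^sub>M {..<k} (\<lambda>_. M)) (product_map k (\<lambda>j. int_iterate (space M) S (n j))))"

definition bernoulli_shift :: "(int \<Rightarrow> 'a) \<Rightarrow> (int \<Rightarrow> 'a)" where
  "bernoulli_shift x = (\<lambda>i. x (i + 1))"

text \<open>
  The product over all integers of the measures \<open>f n(u) du\<close> on \<open>[0,1]\<close> with its Borel
  sigma-algebra. This is the intended measure only if every \<open>f n\<close> is a probability density
  on \<open>[0,1]\<close>.
\<close>

definition bernoulli_measure :: "(int \<Rightarrow> real \<Rightarrow> real) \<Rightarrow> (int \<Rightarrow> real) measure" where
  "bernoulli_measure f =
     Pi\<^sub>M UNIV (\<lambda>n. density (restrict_space lborel {0..1}) (\<lambda>u. ennreal (f n u)))"

end

theory Submission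
  imports Defs "HOL-Real_Asymp.Real_Asymp"
begin

text \<open>
  The product \<open>T\<^bsup>n\<^sub>1\<^esup> \<times> \<dots> \<times> T\<^bsup>n\<^sub>k\<^esup>\<close> acts on a product of measures with densities \<open>\<phi> p\<close>, indexed by
  pairs \<open>p = (j, i)\<close>, through a permutation \<open>\<sigma>\<close> of the indices. Since \<open>\<phi> p\<close> and
  \<open>\<phi> (\<sigma>\<^sup>-\<^sup>n p)\<close> differ on sets of summable measure, the Radon-Nikodym derivative \<open>w\<^sub>n\<close> of the
  \<open>n\<close>-th iterate is, by Borel-Cantelli, almost everywhere a finite product. The integral of
  \<open>1 / w\<^sub>n\<close> is at most \<open>exp (c * \<Sum>\<^bsub>l \<le> C n\<^esub> a\<^sub>l)\<close>, hence \<open>O(\<surd>n)\<close>, and the Cauchy-Schwarz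
  inequality \<open>N\<^sup>2 \<le> \<Sum>w\<^sub>n * \<Sum>1/w\<^sub>n\<close> gives conservativity.

  If \<open>E\<close> is invariant and \<open>C\<close> is a cylinder set close to \<open>E\<close>, then by Hopf's maximal inequality
  the weighted averages of the indicator of \<open>C\<close> are close to the indicator of \<open>E\<close>, uniformly in
  their length. Changing finitely many coordinates of a point eventually multiplies \<open>w\<^sub>n\<close> by a
  constant, so by conservativity it does not change the averages asymptotically. Resampling the
  coordinates on which \<open>C\<close> depends therefore shows that \<open>E\<close> is nearly independent of \<open>C\<close>, hence
  of itself.
\<close>

section \<open>Products of measures with densities\<close>

text \<open>The numbers a_n are not summable, so it is the nesting of the intervals that keeps the
  total change under a shift finite: the differences of masses telescope, and a shift by n changes
  the densities on a set of total mass at most a constant times a_2 + ... + a_(n+1). These sums grow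
  like log log n. Multiplied by any constant and exponentiated they give only a power of log n,
  which stays below the square root of n. Passing to k factors and to the powers n_j merely enlarges
  such constants, and this is why all products of powers can be treated at once. The measure is not
  preserved, so the averages carry the weights \<open>w n\<close>. Conservativity means that the
  sums of the weights diverge; altering finitely many terms of numerator and denominator is then
  negligible in the limit.\<close>

lemma prod_indicator_all:
  "finite F \<Longrightarrow> (\<Prod>p\<in>F. indicator (A p) (y p)) = (if \<forall>p\<in>F. y p \<in> A p then 1 else (0::'b::comm_semiring_1))"
  by (induction F rule: finite_induct) (auto simp: indicator_def)

text \<open>\<open>e\<close> enumerates the index type, so that infinite products can be approached
  through the initial segments \<open>J m\<close> below. The bounds \<open>lo\<close> and
  \<open>hi\<close> let the change of a density be controlled by the \<open>L\<close>-measure of the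
  set where it changes.\<close>

locale density_family = prob_space L for L :: "'a measure" +
  fixes \<phi> :: "'i \<Rightarrow> 'a \<Rightarrow> real" and e :: "nat \<Rightarrow> 'i" and lo hi :: real
  assumes phi_meas [measurable]: "\<And>p. \<phi> p \<in> borel_measurable L"
    and lo_pos: "0 < lo"
    and phi_lo: "\<And>p u. u \<in> space L \<Longrightarrow> lo \<le> \<phi> p u"
    and phi_hi: "\<And>p u. u \<in> space L \<Longrightarrow> \<phi> p u \<le> hi"
    and phi_int: "\<And>p. (\<integral>\<^sup>+u. ennreal (\<phi> p u) \<partial>L) = 1"
    and bij_e: "bij e"
begin

definition P :: "'i \<Rightarrow> 'a measure" where
  "P p = density L (\<lambda>u. ennreal (\<phi> p u))"

definition Y :: "('i \<Rightarrow> 'a) measure" where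
  "Y = Pi\<^sub>M UNIV P"

lemma prob_space_P: "prob_space (P p)"
  by (rule prob_spaceI) (simp add: P_def emeasure_density phi_int)

sublocale PP: product_prob_space P "UNIV :: 'i set"
  by (rule product_prob_spaceI) (rule prob_space_P)

sublocale Y: prob_space Y
  unfolding Y_def by (rule prob_space_PiM) (rule prob_space_P)

lemma space_P [simp]: "space (P p) = space L" and sets_P [simp, measurable_cong]: "sets (P p) = sets L"
  by (simp_all add: P_def)

lemma sets_Y [measurable_cong]: "sets Y = sets (Pi\<^sub>M UNIV (\<lambda>_. L))"
  unfolding Y_def by (rule sets_PiM_cong) auto

lemma space_Y: "space Y = {y. \<forall>p. y p \<in> space L}"
  by (auto simp: Y_def space_PiM PiE_def)

lemma space_YD [simp]: "y \<in> space Y \<Longrightarrow> y p \<in> space L"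
  by (simp add: space_Y)

lemma component_Y [measurable]: "(\<lambda>y. y p) \<in> measurable Y L"
  by (simp add: measurable_cong_sets[OF sets_Y refl])

lemma sets_cylinder1: "A \<in> sets L \<Longrightarrow> {y\<in>space Y. y p \<in> A} \<in> sets Y"
  using measurable_sets_Collect[OF component_Y] by simp

lemma phi_pos: "u \<in> space L \<Longrightarrow> 0 < \<phi> p u"
  using phi_lo[of u p] lo_pos by linarith

lemma nn_integral_P:
  "g \<in> borel_measurable L \<Longrightarrow> (\<integral>\<^sup>+u. g u \<partial>P p) = (\<integral>\<^sup>+u. ennreal (\<phi> p u) * g u \<partial>L)"
  unfolding P_def by (subst nn_integral_density) auto

lemma nn_integral_Y_prod:
  assumes F: "finite F" and g [measurable]: "\<And>p. p \<in> F \<Longrightarrow> g p \<in> borel_measurable L"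
  shows "(\<integral>\<^sup>+y. (\<Prod>p\<in>F. g p (y p)) \<partial>Y) = (\<Prod>p\<in>F. \<integral>\<^sup>+u. ennreal (\<phi> p u) * g p u \<partial>L)"
proof -
  have m: "g p \<in> borel_measurable (P p)" if "p \<in> F" for p
    using g[OF that] by (simp add: measurable_cong_sets[OF sets_P refl])
  have "(\<integral>\<^sup>+y. (\<Prod>p\<in>F. g p (y p)) \<partial>Y) = (\<integral>\<^sup>+y. (\<Prod>p\<in>F. g p (restrict y F p)) \<partial>Y)"
    by (intro nn_integral_cong prod.cong) auto
  also have "\<dots> = (\<integral>\<^sup>+z. (\<Prod>p\<in>F. g p (z p)) \<partial>distr Y (Pi\<^sub>M F P) (\<lambda>y. restrict y F))"
  proof (rule nn_integral_distr[symmetric])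
    show "(\<lambda>y. restrict y F) \<in> measurable Y (Pi\<^sub>M F P)"
      unfolding Y_def by (rule measurable_restrict_subset) simp
    show "(\<lambda>z. \<Prod>p\<in>F. g p (z p)) \<in> borel_measurable (distr Y (Pi\<^sub>M F P) (\<lambda>y. restrict y F))"
      unfolding measurable_distr_eq1
      using m by (intro borel_measurable_prod_ennreal) (auto intro: measurable_compose[OF measurable_component_singleton])
  qed
  also have "distr Y (Pi\<^sub>M F P) (\<lambda>y. restrict y F) = Pi\<^sub>M F P"
    unfolding Y_def by (rule PP.distr_PiM_restrict_finite) (use F in auto)
  also have "(\<integral>\<^sup>+z. (\<Prod>p\<in>F. g p (z p)) \<partial>Pi\<^sub>M F P) = (\<Prod>p\<in>F. \<integral>\<^sup>+u. g p u \<partial>P p)"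
    by (rule PP.product_nn_integral_prod) (use F m in auto)
  finally show ?thesis
    using nn_integral_P g by simp
qed

section \<open>Radon-Nikodym derivatives between permuted products\<close>

definition chg :: "('i \<Rightarrow> 'i) \<Rightarrow> ('i \<Rightarrow> 'a) \<Rightarrow> 'i set" where
  "chg \<tau> y = {p. \<phi> (\<tau> p) (y p) \<noteq> \<phi> p (y p)}"

text \<open>The density of the product of the \<open>P (\<tau> p)\<close> with respect to
  \<open>Y\<close>, in the spirit of Kakutani. Where \<open>chg \<tau> y\<close> is infinite, the
  product takes its default value 1; thus \<open>W\<close> is positive everywhere, while its
  algebraic identities can only be expected almost everywhere.\<close>

definition W :: "('i \<Rightarrow> 'i) \<Rightarrow> ('i \<Rightarrow> 'a) \<Rightarrow> real" where
  "W \<tau> y = (\<Prod>p\<in>chg \<tau> y. \<phi> (\<tau> p) (y p) / \<phi> p (y p))"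

lemma W_superset:
  assumes "y \<in> space Y" "finite F" "chg \<tau> y \<subseteq> F"
  shows "W \<tau> y = (\<Prod>p\<in>F. \<phi> (\<tau> p) (y p) / \<phi> p (y p))"
  unfolding W_def
  by (rule prod.mono_neutral_left)
     (use assms phi_pos in \<open>auto simp: chg_def less_imp_neq[symmetric]\<close>)

lemma W_pos: "y \<in> space Y \<Longrightarrow> 0 < W \<tau> y"
  unfolding W_def by (intro prod_pos) (simp add: phi_pos)

definition J :: "nat \<Rightarrow> 'i set" where "J m = e ` {..<m}"

lemma finite_J [simp]: "finite (J m)" by (simp add: J_def)

lemma J_Suc: "J (Suc m) = insert (e m) (J m)"
  by (simp add: J_def lessThan_Suc)

lemma e_notin_J: "e m \<notin> J m"
  using bij_e by (auto simp: J_def dest: bij_is_inj injD)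

lemma sum_J: "sum g (J m) = (\<Sum>k<m. g (e k))"
  unfolding J_def using bij_e by (subst sum.reindex) (auto simp: inj_on_def dest: bij_is_inj injD)

lemma J_eventually_superset:
  assumes "finite F" shows "\<forall>\<^sub>F m in sequentially. F \<subseteq> J m"
proof -
  have "\<forall>\<^sub>F m in sequentially. p \<in> J m" for p
  proof -
    obtain k where "p = e k" using bij_e by (metis bij_pointE)
    then have *: "p \<in> J m" if "k < m" for m using that by (auto simp: J_def)
    show ?thesis
      using eventually_gt_at_top[of k] by (rule eventually_mono) (rule *)
  qed
  then have "\<forall>\<^sub>F m in sequentially. \<forall>p\<in>F. p \<in> J m"
    using assms by (simp add: eventually_ball_finite)
  then show ?thesis by (simp add: subset_iff Ball_def)
qed

text \<open>Unlike \<open>W\<close>, this is a product over a set that does not depend on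
  \<open>y\<close>, so its integrals factor over the coordinates.\<close>

definition Wpart :: "('i \<Rightarrow> 'i) \<Rightarrow> nat \<Rightarrow> ('i \<Rightarrow> 'a) \<Rightarrow> real" where
  "Wpart \<tau> m y = (\<Prod>p\<in>J m. \<phi> (\<tau> p) (y p) / \<phi> p (y p))"

lemma Wpart_meas [measurable]: "Wpart \<tau> m \<in> borel_measurable Y"
  unfolding Wpart_def by measurable

lemma Wpart_pos: "y \<in> space Y \<Longrightarrow> 0 < Wpart \<tau> m y"
  unfolding Wpart_def by (intro prod_pos) (simp add: phi_pos)

lemma Wpart_eventually:
  assumes "y \<in> space Y" "finite (chg \<tau> y)"
  shows "\<forall>\<^sub>F m in sequentially. Wpart \<tau> m y = W \<tau> y"
  using J_eventually_superset[OF assms(2)]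
  by eventually_elim (use W_superset[OF assms(1) finite_J] in \<open>simp add: Wpart_def\<close>)

text \<open>Along the enumeration, finiteness becomes a countable combination of measurable
  conditions; this form serves both measurability and Borel-Cantelli.\<close>

lemma finite_chg_iff: "finite (chg \<tau> y) \<longleftrightarrow> (\<exists>m. \<forall>k\<ge>m. \<phi> (\<tau> (e k)) (y (e k)) = \<phi> (e k) (y (e k)))"
proof
  assume "finite (chg \<tau> y)"
  then obtain m where "\<And>n. n \<ge> m \<Longrightarrow> chg \<tau> y \<subseteq> J n"
    using J_eventually_superset by (meson eventually_sequentially)
  then show "\<exists>m. \<forall>k\<ge>m. \<phi> (\<tau> (e k)) (y (e k)) = \<phi> (e k) (y (e k))"
    using e_notin_J by (force simp: chg_def)
next
  assume "\<exists>m. \<forall>k\<ge>m. \<phi> (\<tau> (e k)) (y (e k)) = \<phi> (e k) (y (e k))"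
  then obtain m where m: "\<And>k. k \<ge> m \<Longrightarrow> \<phi> (\<tau> (e k)) (y (e k)) = \<phi> (e k) (y (e k))" by auto
  have "chg \<tau> y \<subseteq> J m"
  proof
    fix p assume p: "p \<in> chg \<tau> y"
    obtain k where "p = e k" using bij_e by (metis bij_pointE)
    with p m[of k] have "k < m" by (force simp: chg_def not_le[symmetric])
    with \<open>p = e k\<close> show "p \<in> J m" by (simp add: J_def)
  qed
  then show "finite (chg \<tau> y)" using finite_subset finite_J by blast
qed

lemma pred_finite_chg [measurable]: "Measurable.pred Y (\<lambda>y. finite (chg \<tau> y))"
  unfolding finite_chg_iff by measurable

lemma W_meas [measurable]: "W \<tau> \<in> borel_measurable Y"
proof -
  \<comment> \<open>The value 1 in the exceptional case is the one that \<open>W\<close> takes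
    there, so the limit holds at every point.\<close>
  have "(\<lambda>m. if finite (chg \<tau> y) then Wpart \<tau> m y else 1) \<longlonglongrightarrow> W \<tau> y" if "y \<in> space Y" for y
  proof (cases "finite (chg \<tau> y)")
    case True
    then show ?thesis
      using tendsto_eventually[OF Wpart_eventually[OF that True]] by simp
  qed (simp add: W_def)
  then show ?thesis
    by (rule borel_measurable_LIMSEQ_metric[rotated]) measurable
qed

definition dist_mass :: "('i \<Rightarrow> 'i) \<Rightarrow> 'i \<Rightarrow> real" where
  "dist_mass \<tau> p = measure L {u\<in>space L. \<phi> (\<tau> p) u \<noteq> \<phi> p u}"

lemma lo_le_hi: "lo \<le> hi"
proof -
  obtain u where "u \<in> space L" using not_empty by auto
  then show ?thesis using phi_lo phi_hi order_trans by blast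
qed

lemma hi_pos: "0 < hi" using lo_pos lo_le_hi by linarith

text \<open>The integral factors. In each coordinate the ratio replaces the density
  \<open>\<phi> p\<close> by \<open>\<phi> (\<tau> p)\<close>, and a coordinate outside
  \<open>F\<close> then integrates to 1.\<close>

lemma nn_integral_Wpart_cyl:
  assumes F: "finite F" "F \<subseteq> J m" and A: "\<And>p. p \<in> F \<Longrightarrow> A p \<in> sets L"
  shows "(\<integral>\<^sup>+y. ennreal (Wpart \<tau> m y) * indicator {y\<in>space Y. \<forall>p\<in>F. y p \<in> A p} y \<partial>Y)
    = (\<Prod>p\<in>F. emeasure (P (\<tau> p)) (A p))"
proof -
  define g where "g p u = ennreal (\<phi> (\<tau> p) u / \<phi> p u) * (if p \<in> F then indicator (A p) u else 1)" for p u
  have [measurable]: "g p \<in> borel_measurable L" for p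
    unfolding g_def by (cases "p \<in> F") (use A in simp_all)
  have "(\<integral>\<^sup>+y. ennreal (Wpart \<tau> m y) * indicator {y\<in>space Y. \<forall>p\<in>F. y p \<in> A p} y \<partial>Y)
    = (\<integral>\<^sup>+y. (\<Prod>p\<in>J m. g p (y p)) \<partial>Y)"
  proof (rule nn_integral_cong)
    fix y assume y: "y \<in> space Y"
    have "(\<Prod>p\<in>J m. (if p \<in> F then indicator (A p) (y p) else 1::ennreal)) = (\<Prod>p\<in>F. indicator (A p) (y p))"
      using F by (subst prod.inter_restrict[symmetric]) (auto simp: Int_absorb1)
    also have "\<dots> = indicator {y\<in>space Y. \<forall>p\<in>F. y p \<in> A p} y"
      using y by (subst prod_indicator_all[OF F(1)]) (auto simp: indicator_def)
    finally show "ennreal (Wpart \<tau> m y) * indicator {y\<in>space Y. \<forall>p\<in>F. y p \<in> A p} y = (\<Prod>p\<in>J m. g p (y p))"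
      using y by (simp add: g_def prod.distrib Wpart_def prod_ennreal phi_pos less_imp_le)
  qed
  also have "\<dots> = (\<Prod>p\<in>J m. \<integral>\<^sup>+u. ennreal (\<phi> p u) * g p u \<partial>L)"
    by (rule nn_integral_Y_prod) auto
  also have "\<dots> = (\<Prod>p\<in>J m. if p \<in> F then emeasure (P (\<tau> p)) (A p) else 1)"
  proof (rule prod.cong[OF refl])
    fix p
    have "(\<integral>\<^sup>+u. ennreal (\<phi> p u) * g p u \<partial>L)
       = (\<integral>\<^sup>+u. ennreal (\<phi> (\<tau> p) u) * (if p \<in> F then indicator (A p) u else 1) \<partial>L)"
    proof (rule nn_integral_cong)
      fix u assume u: "u \<in> space L"
      have "ennreal (\<phi> p u) * ennreal (\<phi> (\<tau> p) u / \<phi> p u) = ennreal (\<phi> (\<tau> p) u)"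
        using phi_pos[OF u, of p] phi_pos[OF u, of "\<tau> p"] by (subst ennreal_mult[symmetric]) auto
      then show "ennreal (\<phi> p u) * g p u = ennreal (\<phi> (\<tau> p) u) * (if p \<in> F then indicator (A p) u else 1)"
        unfolding g_def by (metis mult.assoc)
    qed
    also have "\<dots> = (if p \<in> F then emeasure (P (\<tau> p)) (A p) else 1)"
      using A by (auto simp: P_def emeasure_density phi_int)
    finally show "(\<integral>\<^sup>+u. ennreal (\<phi> p u) * g p u \<partial>L) = (if p \<in> F then emeasure (P (\<tau> p)) (A p) else 1)" .
  qed
  also have "\<dots> = (\<Prod>p\<in>F. emeasure (P (\<tau> p)) (A p))"
    using F by (subst prod.inter_restrict[symmetric]) (auto simp: Int_absorb1)
  finally show ?thesis .
qed

text \<open>The increment is \<open>Wpart \<tau> m\<close>, of integral 1, times the ratio minus 1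
  in the independent coordinate \<open>e m\<close>. Against \<open>\<phi> (e m)\<close> the latter
  becomes the difference of two densities, which is at most \<open>2 * hi\<close> and vanishes off
  the set measured by \<open>dist_mass\<close>.\<close>

lemma nn_integral_Wpart_diff:
  "(\<integral>\<^sup>+y. ennreal \<bar>Wpart \<tau> (Suc m) y - Wpart \<tau> m y\<bar> \<partial>Y) \<le> ennreal (2 * hi * dist_mass \<tau> (e m))"
proof -
  define g where "g p u = (if p = e m then ennreal \<bar>\<phi> (\<tau> p) u / \<phi> p u - 1\<bar> else ennreal (\<phi> (\<tau> p) u / \<phi> p u))" for p u
  have [measurable]: "g p \<in> borel_measurable L" for p
    unfolding g_def by (cases "p = e m") simp_all
  have "(\<integral>\<^sup>+y. ennreal \<bar>Wpart \<tau> (Suc m) y - Wpart \<tau> m y\<bar> \<partial>Y) = (\<integral>\<^sup>+y. (\<Prod>p\<in>J (Suc m). g p (y p)) \<partial>Y)"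
  proof (rule nn_integral_cong)
    fix y assume y: "y \<in> space Y"
    have "Wpart \<tau> (Suc m) y - Wpart \<tau> m y = (\<phi> (\<tau> (e m)) (y (e m)) / \<phi> (e m) (y (e m)) - 1) * Wpart \<tau> m y"
      by (simp add: Wpart_def J_Suc e_notin_J algebra_simps)
    then have "ennreal \<bar>Wpart \<tau> (Suc m) y - Wpart \<tau> m y\<bar> = g (e m) (y (e m)) * ennreal (Wpart \<tau> m y)"
      using Wpart_pos[OF y, of \<tau> m] by (simp add: abs_mult ennreal_mult g_def)
    also have "ennreal (Wpart \<tau> m y) = (\<Prod>p\<in>J m. g p (y p))"
      using y e_notin_J[of m] unfolding Wpart_def
      by (subst prod_ennreal[symmetric]) (auto simp: g_def phi_pos less_imp_le intro!: prod.cong)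
    finally show "ennreal \<bar>Wpart \<tau> (Suc m) y - Wpart \<tau> m y\<bar> = (\<Prod>p\<in>J (Suc m). g p (y p))"
      by (simp add: J_Suc e_notin_J)
  qed
  also have "\<dots> = (\<Prod>p\<in>J (Suc m). \<integral>\<^sup>+u. ennreal (\<phi> p u) * g p u \<partial>L)"
    by (rule nn_integral_Y_prod) auto
  also have "\<dots> = (\<integral>\<^sup>+u. ennreal (\<phi> (e m) u) * g (e m) u \<partial>L) * (\<Prod>p\<in>J m. \<integral>\<^sup>+u. ennreal (\<phi> p u) * g p u \<partial>L)"
    by (simp add: J_Suc e_notin_J)
  also have "(\<Prod>p\<in>J m. \<integral>\<^sup>+u. ennreal (\<phi> p u) * g p u \<partial>L) = 1"
  proof (rule prod.neutral, rule ballI)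
    fix p assume "p \<in> J m"
    then have "p \<noteq> e m" using e_notin_J by auto
    then have "(\<integral>\<^sup>+u. ennreal (\<phi> p u) * g p u \<partial>L) = (\<integral>\<^sup>+u. ennreal (\<phi> (\<tau> p) u) \<partial>L)"
      by (intro nn_integral_cong)
         (simp add: g_def ennreal_mult[symmetric] phi_pos less_imp_le less_imp_neq[symmetric])
    then show "(\<integral>\<^sup>+u. ennreal (\<phi> p u) * g p u \<partial>L) = 1" by (simp add: phi_int)
  qed
  also have "(\<integral>\<^sup>+u. ennreal (\<phi> (e m) u) * g (e m) u \<partial>L)
      \<le> (\<integral>\<^sup>+u. ennreal (2 * hi) * indicator {u\<in>space L. \<phi> (\<tau> (e m)) u \<noteq> \<phi> (e m) u} u \<partial>L)"
  proof (rule nn_integral_mono)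
    fix u assume u: "u \<in> space L"
    have "\<phi> (e m) u * \<bar>\<phi> (\<tau> (e m)) u / \<phi> (e m) u - 1\<bar> = \<bar>\<phi> (\<tau> (e m)) u - \<phi> (e m) u\<bar>"
      using phi_pos[OF u, of "e m"] by (simp add: abs_if field_simps)
    also have "\<dots> \<le> 2 * hi" "\<phi> (\<tau> (e m)) u = \<phi> (e m) u \<Longrightarrow> \<bar>\<phi> (\<tau> (e m)) u - \<phi> (e m) u\<bar> = 0"
      using phi_pos[OF u, of "e m"] phi_pos[OF u, of "\<tau> (e m)"] phi_hi[OF u, of "e m"] phi_hi[OF u, of "\<tau> (e m)"]
      by auto
    ultimately show "ennreal (\<phi> (e m) u) * g (e m) u
       \<le> ennreal (2 * hi) * indicator {u\<in>space L. \<phi> (\<tau> (e m)) u \<noteq> \<phi> (e m) u} u"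
      using u by (auto simp: g_def ennreal_mult[symmetric] phi_pos less_imp_le indicator_def)
  qed
  also have "\<dots> = ennreal (2 * hi * dist_mass \<tau> (e m))"
    using hi_pos by (subst nn_integral_cmult_indicator) (auto simp: dist_mass_def emeasure_eq_measure ennreal_mult)
  finally show ?thesis by (simp add: mult_right_mono)
qed

context
  fixes \<tau> :: "'i \<Rightarrow> 'i" and D :: real
  assumes D: "\<And>F. finite F \<Longrightarrow> (\<Sum>p\<in>F. dist_mass \<tau> p) \<le> D"
begin

lemma summable_dist_mass: "summable (\<lambda>m. dist_mass \<tau> (e m))"
proof (rule summableI_nonneg_bounded)
  show "(\<Sum>k<m. dist_mass \<tau> (e k)) \<le> D" for m
    using D[OF finite_J[of m]] by (simp add: sum_J)
qed (simp add: dist_mass_def)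

lemma AE_finite_chg: "AE y in Y. finite (chg \<tau> y)"
proof -
  define A where "A m = {y\<in>space Y. \<phi> (\<tau> (e m)) (y (e m)) \<noteq> \<phi> (e m) (y (e m))}" for m
  have [measurable]: "A m \<in> sets Y" for m unfolding A_def by measurable
  have A: "measure Y (A m) \<le> hi * dist_mass \<tau> (e m)" for m
  proof -
    let ?B = "{u\<in>space L. \<phi> (\<tau> (e m)) u \<noteq> \<phi> (e m) u}"
    have "emeasure Y (A m) = (\<integral>\<^sup>+y. (\<Prod>p\<in>{e m}. indicator ?B (y p)) \<partial>Y)"
      unfolding nn_integral_indicator[OF \<open>A m \<in> sets Y\<close>, symmetric]
      by (rule nn_integral_cong) (auto simp: A_def indicator_def)
    also have "\<dots> = (\<integral>\<^sup>+u. ennreal (\<phi> (e m) u) * indicator ?B u \<partial>L)"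
      by (subst nn_integral_Y_prod) auto
    also have "\<dots> \<le> (\<integral>\<^sup>+u. ennreal hi * indicator ?B u \<partial>L)"
      by (intro nn_integral_mono mult_right_mono ennreal_leI phi_hi) auto
    also have "\<dots> = ennreal (hi * dist_mass \<tau> (e m))"
      using hi_pos by (subst nn_integral_cmult_indicator) (auto simp: dist_mass_def emeasure_eq_measure ennreal_mult)
    finally show ?thesis
      using hi_pos by (simp add: Y.emeasure_eq_measure dist_mass_def)
  qed
  have "summable (\<lambda>m. measure Y (A m))"
    by (rule summable_comparison_test'[of "\<lambda>m. hi * dist_mass \<tau> (e m)" 0])
       (use A summable_dist_mass in \<open>auto intro: summable_mult\<close>)
  then have "AE y in Y. eventually (\<lambda>m. y \<in> space Y - A m) sequentially"
    by (intro borel_cantelli_AE1) (auto simp: less_top[symmetric])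
  then show ?thesis
    by eventually_elim (auto simp: A_def finite_chg_iff eventually_sequentially)
qed

lemma AE_Wpart_tendsto: "AE y in Y. (\<lambda>m. Wpart \<tau> m y) \<longlonglongrightarrow> W \<tau> y"
  using AE_finite_chg AE_space by eventually_elim (auto intro: tendsto_eventually Wpart_eventually)

text \<open>Both sides are compared on cylinders, where the partial products have constant integrals
  once \<open>J m\<close> contains the base. Pointwise convergence alone would allow mass to be lost
  in the limit; the summable increments supply an integrable majorant.\<close>

lemma density_W: "density Y (\<lambda>y. ennreal (W \<tau> y)) = Pi\<^sub>M UNIV (\<lambda>p. P (\<tau> p))"
proof (rule measure_eqI_PiM_infinite[symmetric, OF refl])
  show "sets (density Y (\<lambda>y. ennreal (W \<tau> y))) = sets (Pi\<^sub>M UNIV (\<lambda>p. P (\<tau> p)))"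
    unfolding sets_density sets_Y by (rule sets_PiM_cong) auto
  interpret Q: prob_space "Pi\<^sub>M UNIV (\<lambda>p. P (\<tau> p))"
    by (rule prob_space_PiM) (rule prob_space_P)
  show "finite_measure (Pi\<^sub>M UNIV (\<lambda>p. P (\<tau> p)))" by unfold_locales
  fix A F assume F: "finite F" "F \<subseteq> UNIV" and A: "\<And>p. p \<in> F \<Longrightarrow> A p \<in> sets (P (\<tau> p))"
  let ?E = "{y\<in>space Y. \<forall>p\<in>F. y p \<in> A p}"
  have A': "A p \<in> sets L" if "p \<in> F" for p using A[OF that] by simp
  have emb: "prod_emb UNIV (\<lambda>p. P (\<tau> p)) F (Pi\<^sub>E F A) = ?E"
    unfolding prod_emb_def space_Y space_P by (rule set_eqI) (simp add: PiE_iff conj_commute)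
  have [measurable]: "?E \<in> sets Y"
    using F(1) A' by (intro sets.sets_Collect_finite_All sets_cylinder1)
  \<comment> \<open>Since \<open>Wpart \<tau> 0 y = 1\<close>, telescoping bounds every partial
    product by \<open>h\<close>.\<close>
  define h where "h y = 1 + (\<Sum>m. ennreal \<bar>Wpart \<tau> (Suc m) y - Wpart \<tau> m y\<bar>)" for y
  have [measurable]: "h \<in> borel_measurable Y" unfolding h_def by measurable
  have h: "ennreal (Wpart \<tau> m y) \<le> h y" for m y
  proof -
    have "Wpart \<tau> m y = 1 + (\<Sum>k<m. Wpart \<tau> (Suc k) y - Wpart \<tau> k y)"
      by (subst sum_lessThan_telescope) (simp add: Wpart_def J_def)
    also have "\<dots> \<le> 1 + (\<Sum>k<m. \<bar>Wpart \<tau> (Suc k) y - Wpart \<tau> k y\<bar>)"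
      by (intro add_left_mono sum_mono) auto
    finally have "ennreal (Wpart \<tau> m y) \<le> 1 + (\<Sum>k<m. ennreal \<bar>Wpart \<tau> (Suc k) y - Wpart \<tau> k y\<bar>)"
      by (subst sum_ennreal) (simp_all add: ennreal_leI sum_nonneg flip: ennreal_1 ennreal_plus)
    also have "\<dots> \<le> h y"
      unfolding h_def by (intro add_left_mono sum_le_suminf) auto
    finally show ?thesis .
  qed
  have "(\<integral>\<^sup>+y. h y \<partial>Y) = 1 + (\<Sum>m. \<integral>\<^sup>+y. ennreal \<bar>Wpart \<tau> (Suc m) y - Wpart \<tau> m y\<bar> \<partial>Y)"
    unfolding h_def by (subst nn_integral_add) (auto simp: nn_integral_suminf Y.emeasure_space_1)
  also have "\<dots> \<le> 1 + (\<Sum>m. ennreal (2 * hi * dist_mass \<tau> (e m)))"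
    by (intro add_left_mono suminf_le nn_integral_Wpart_diff) auto
  also have "\<dots> < \<infinity>"
    using summable_mult[OF summable_dist_mass, of "2 * hi"] hi_pos
    by (subst suminf_ennreal2) (auto simp: dist_mass_def)
  finally have h_int: "(\<integral>\<^sup>+y. h y \<partial>Y) < \<infinity>" .
  have "(\<lambda>m. \<integral>\<^sup>+y. ennreal (Wpart \<tau> m y) * indicator ?E y \<partial>Y) \<longlonglongrightarrow> (\<integral>\<^sup>+y. ennreal (W \<tau> y) * indicator ?E y \<partial>Y)"
  proof (rule nn_integral_dominated_convergence[where w = h])
    show "AE y in Y. ennreal (Wpart \<tau> m y) * indicator ?E y \<le> h y" for m
      using h[of m] by (auto simp: indicator_def)
    show "AE y in Y. (\<lambda>m. ennreal (Wpart \<tau> m y) * indicator ?E y) \<longlonglongrightarrow> ennreal (W \<tau> y) * indicator ?E y"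
      using AE_Wpart_tendsto by eventually_elim (auto simp: indicator_def)
  qed (use h_int in auto)
  moreover have "\<forall>\<^sub>F m in sequentially. (\<integral>\<^sup>+y. ennreal (Wpart \<tau> m y) * indicator ?E y \<partial>Y) = (\<Prod>p\<in>F. emeasure (P (\<tau> p)) (A p))"
    using J_eventually_superset[OF F(1)] by eventually_elim (rule nn_integral_Wpart_cyl[OF F(1) _ A'])
  ultimately have "(\<integral>\<^sup>+y. ennreal (W \<tau> y) * indicator ?E y \<partial>Y) = (\<Prod>p\<in>F. emeasure (P (\<tau> p)) (A p))"
    by (rule LIMSEQ_unique[OF _ tendsto_eventually])
  moreover have "emeasure (Pi\<^sub>M UNIV (\<lambda>p. P (\<tau> p))) (prod_emb UNIV (\<lambda>p. P (\<tau> p)) F (Pi\<^sub>E F A))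
      = (\<Prod>p\<in>F. emeasure (P (\<tau> p)) (A p))"
    by (rule emeasure_PiM_emb) (use F A prob_space_P in auto)
  moreover have "emeasure (density Y (\<lambda>y. ennreal (W \<tau> y))) ?E = (\<integral>\<^sup>+y. ennreal (W \<tau> y) * indicator ?E y \<partial>Y)"
    by (rule emeasure_density) measurable
  ultimately show "emeasure (Pi\<^sub>M UNIV (\<lambda>p. P (\<tau> p))) (prod_emb UNIV (\<lambda>p. P (\<tau> p)) F (Pi\<^sub>E F A))
     = emeasure (density Y (\<lambda>y. ennreal (W \<tau> y))) (prod_emb UNIV (\<lambda>p. P (\<tau> p)) F (Pi\<^sub>E F A))"
    unfolding emb by simp
qed

text \<open>Each coordinate contributes the integral of \<open>\<phi> p\<close> squared over
  \<open>\<phi> (\<tau> p)\<close>. The integrand is \<open>\<phi> p\<close> where the densities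
  agree and at most \<open>hi\<^sup>2 / lo\<close> elsewhere, so 1 + x \<le> exp x turns the product
  into the exponential of a sum. Fatou's lemma passes from \<open>Wpart\<close> to
  \<open>W\<close>.\<close>

lemma nn_integral_inverse_W:
  "(\<integral>\<^sup>+y. ennreal (1 / W \<tau> y) \<partial>Y) \<le> ennreal (exp (hi\<^sup>2 / lo * D))"
proof -
  have part: "(\<integral>\<^sup>+y. ennreal (1 / Wpart \<tau> m y) \<partial>Y) \<le> ennreal (exp (hi\<^sup>2 / lo * D))" for m
  proof -
    have "(\<integral>\<^sup>+y. ennreal (1 / Wpart \<tau> m y) \<partial>Y) = (\<integral>\<^sup>+y. (\<Prod>p\<in>J m. ennreal (\<phi> p (y p) / \<phi> (\<tau> p) (y p))) \<partial>Y)"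
      by (intro nn_integral_cong, subst prod_ennreal)
         (auto simp: Wpart_def prod_dividef phi_pos less_imp_le)
    also have "\<dots> = (\<Prod>p\<in>J m. \<integral>\<^sup>+u. ennreal (\<phi> p u) * ennreal (\<phi> p u / \<phi> (\<tau> p) u) \<partial>L)"
      by (rule nn_integral_Y_prod) auto
    also have "\<dots> \<le> (\<Prod>p\<in>J m. ennreal (exp (hi\<^sup>2 / lo * dist_mass \<tau> p)))"
    proof (intro prod_mono_ennreal)
      fix p
      let ?B = "{u\<in>space L. \<phi> (\<tau> p) u \<noteq> \<phi> p u}"
      have "(\<integral>\<^sup>+u. ennreal (\<phi> p u) * ennreal (\<phi> p u / \<phi> (\<tau> p) u) \<partial>L)
          \<le> (\<integral>\<^sup>+u. ennreal (\<phi> p u) + ennreal (hi\<^sup>2 / lo) * indicator ?B u \<partial>L)"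
      proof (rule nn_integral_mono)
        fix u assume u: "u \<in> space L"
        have "\<phi> p u * (\<phi> p u / \<phi> (\<tau> p) u) \<le> hi\<^sup>2 / lo"
          unfolding times_divide_eq_right power2_eq_square
          by (intro frac_le mult_mono) (use phi_pos[OF u, of p] phi_pos[OF u, of "\<tau> p"] lo_pos hi_pos phi_hi phi_lo u in \<open>auto simp: less_imp_le\<close>)
        moreover have "\<phi> (\<tau> p) u = \<phi> p u \<Longrightarrow> \<phi> p u * (\<phi> p u / \<phi> (\<tau> p) u) = \<phi> p u"
          using phi_pos[OF u, of p] by simp
        ultimately show "ennreal (\<phi> p u) * ennreal (\<phi> p u / \<phi> (\<tau> p) u) \<le> ennreal (\<phi> p u) + ennreal (hi\<^sup>2 / lo) * indicator ?B u"
          using u phi_pos[OF u, of p] phi_pos[OF u, of "\<tau> p"] lo_pos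
          by (auto simp: ennreal_mult[symmetric] less_imp_le indicator_def ennreal_plus[symmetric] simp del: ennreal_plus intro!: ennreal_leI)
      qed
      also have "\<dots> = 1 + ennreal (hi\<^sup>2 / lo) * ennreal (dist_mass \<tau> p)"
        by (subst nn_integral_add) (auto simp: phi_int nn_integral_cmult_indicator dist_mass_def emeasure_eq_measure)
      also have "\<dots> = ennreal (1 + hi\<^sup>2 / lo * dist_mass \<tau> p)"
        using lo_pos by (simp add: ennreal_mult[symmetric] dist_mass_def)
      also have "\<dots> \<le> ennreal (exp (hi\<^sup>2 / lo * dist_mass \<tau> p))"
        by (intro ennreal_leI exp_ge_add_one_self)
      finally show "(\<integral>\<^sup>+u. ennreal (\<phi> p u) * ennreal (\<phi> p u / \<phi> (\<tau> p) u) \<partial>L) \<le> ennreal (exp (hi\<^sup>2 / lo * dist_mass \<tau> p))" .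
    qed
    also have "\<dots> = ennreal (exp (hi\<^sup>2 / lo * (\<Sum>p\<in>J m. dist_mass \<tau> p)))"
      by (subst prod_ennreal) (auto simp: exp_sum[symmetric] sum_distrib_left)
    also have "\<dots> \<le> ennreal (exp (hi\<^sup>2 / lo * D))"
      using D[of "J m"] lo_pos by (intro ennreal_leI) (simp add: divide_right_mono mult_left_mono)
    finally show ?thesis .
  qed
  have "(\<integral>\<^sup>+y. ennreal (1 / W \<tau> y) \<partial>Y) = (\<integral>\<^sup>+y. liminf (\<lambda>m. ennreal (1 / Wpart \<tau> m y)) \<partial>Y)"
  proof (rule nn_integral_cong_AE)
    show "AE y in Y. ennreal (1 / W \<tau> y) = liminf (\<lambda>m. ennreal (1 / Wpart \<tau> m y))"
      using AE_Wpart_tendsto AE_space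
    proof eventually_elim
      fix y assume "(\<lambda>m. Wpart \<tau> m y) \<longlonglongrightarrow> W \<tau> y" "y \<in> space Y"
      then have "(\<lambda>m. ennreal (1 / Wpart \<tau> m y)) \<longlonglongrightarrow> ennreal (1 / W \<tau> y)"
        using W_pos[of y \<tau>] by (intro tendsto_intros) auto
      then show "ennreal (1 / W \<tau> y) = liminf (\<lambda>m. ennreal (1 / Wpart \<tau> m y))"
        by (simp add: lim_imp_Liminf)
    qed
  qed
  also have "\<dots> \<le> liminf (\<lambda>m. \<integral>\<^sup>+y. ennreal (1 / Wpart \<tau> m y) \<partial>Y)"
    by (rule nn_integral_liminf) measurable
  also have "\<dots> \<le> ennreal (exp (hi\<^sup>2 / lo * D))"
    by (rule Liminf_le) (simp_all only: part eventually_True trivial_limit_sequentially not_False_eq_True)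
  finally show ?thesis .
qed

end

end

section \<open>Nonsingular cocycles\<close>

text \<open>By \<open>transfer\<close>, \<open>w 1\<close> is the derivative of the measure moved by
  \<open>S\<close>; the cocycle identity makes \<open>w n\<close> the one of the \<open>n\<close>-th
  iterate. It holds only almost everywhere because the intended \<open>w\<close> has default values
  on a null set.\<close>

locale nonsingular_cocycle = prob_space M for M :: "'a measure" +
  fixes S :: "'a \<Rightarrow> 'a" and w :: "nat \<Rightarrow> 'a \<Rightarrow> real"
  assumes S_meas [measurable]: "S \<in> measurable M M"
    and w_meas [measurable]: "\<And>n. w n \<in> borel_measurable M"
    and w_pos: "\<And>n x. x \<in> space M \<Longrightarrow> 0 < w n x"
    and w_0: "\<And>x. x \<in> space M \<Longrightarrow> w 0 x = 1"
    and transfer: "\<And>g. g \<in> borel_measurable M \<Longrightarrow> (\<integral>\<^sup>+x. ennreal (w 1 x) * g (S x) \<partial>M) = (\<integral>\<^sup>+x. g x \<partial>M)"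
    and cocycle: "\<And>n. AE x in M. w (Suc n) x = w 1 x * w n (S x)"
begin

lemma S_space: "x \<in> space M \<Longrightarrow> S x \<in> space M"
  using measurable_space[OF S_meas] .

lemma funpow_S_meas [measurable]: "S ^^ n \<in> measurable M M"
  by (rule measurable_compose_n) measurable

text \<open>By \<open>transfer\<close>, the measure of \<open>E\<close> is the integral of a
  strictly positive weight over the preimage.\<close>

lemma emeasure_vimage_eq_0_iff:
  assumes [measurable]: "E \<in> sets M"
  shows "emeasure M (S -` E \<inter> space M) = 0 \<longleftrightarrow> emeasure M E = 0"
proof -
  have "emeasure M E = (\<integral>\<^sup>+x. indicator E x \<partial>M)" by simp
  also have "\<dots> = (\<integral>\<^sup>+x. ennreal (w 1 x) * indicator E (S x) \<partial>M)"
    by (rule transfer[symmetric]) measurable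
  finally have "emeasure M E = 0 \<longleftrightarrow> (AE x in M. ennreal (w 1 x) * indicator E (S x) = 0)"
    by (simp add: nn_integral_0_iff_AE)
  also have "\<dots> \<longleftrightarrow> (AE x in M. x \<notin> S -` E \<inter> space M)"
  proof (rule AE_cong)
    fix x assume "x \<in> space M"
    then show "(ennreal (w 1 x) * indicator E (S x) = 0) = (x \<notin> S -` E \<inter> space M)"
      using w_pos[of x 1] by (auto simp: indicator_def)
  qed
  also have "\<dots> \<longleftrightarrow> emeasure M (S -` E \<inter> space M) = 0"
    by (subst AE_iff_measurable[where N = "S -` E \<inter> space M"]) auto
  finally show ?thesis by simp
qed

lemma AE_shift: "AE x in M. Q x \<Longrightarrow> AE x in M. Q (S x)"
proof (elim AE_E)
  fix N assume N: "{x \<in> space M. \<not> Q x} \<subseteq> N" "emeasure M N = 0" "N \<in> sets M"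
  show "AE x in M. Q (S x)"
  proof (rule AE_I)
    show "{x \<in> space M. \<not> Q (S x)} \<subseteq> S -` N \<inter> space M" using N S_space by auto
    show "emeasure M (S -` N \<inter> space M) = 0" using N emeasure_vimage_eq_0_iff by simp
  qed (use N in measurable)
qed

lemma transfer_integrable:
  assumes h: "integrable M h" "\<And>x. x \<in> space M \<Longrightarrow> 0 \<le> h x"
  shows "integrable M (\<lambda>x. w 1 x * h (S x))" "(\<integral>x. w 1 x * h (S x) \<partial>M) = (\<integral>x. h x \<partial>M)"
proof -
  have [measurable]: "h \<in> borel_measurable M" using h by auto
  have *: "(\<integral>\<^sup>+x. ennreal (w 1 x * h (S x)) \<partial>M) = ennreal (\<integral>x. h x \<partial>M)"
  proof -
    have "(\<integral>\<^sup>+x. ennreal (w 1 x * h (S x)) \<partial>M) = (\<integral>\<^sup>+x. ennreal (w 1 x) * ennreal (h (S x)) \<partial>M)"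
      by (intro nn_integral_cong ennreal_mult) (auto simp: w_pos less_imp_le h S_space)
    also have "\<dots> = (\<integral>\<^sup>+x. ennreal (h x) \<partial>M)"
      by (rule transfer[of "\<lambda>x. ennreal (h x)"]) measurable
    finally show ?thesis using h by (simp add: nn_integral_eq_integral)
  qed
  have nn: "0 \<le> (\<integral>x. h x \<partial>M)" using h by (intro integral_nonneg_AE AE_I2) auto
  have "has_bochner_integral M (\<lambda>x. w 1 x * h (S x)) (\<integral>x. h x \<partial>M)"
    by (rule has_bochner_integral_nn_integral[OF _ _ nn *])
       (auto intro!: AE_I2 mult_nonneg_nonneg simp: w_pos less_imp_le h S_space)
  then show "integrable M (\<lambda>x. w 1 x * h (S x))" "(\<integral>x. w 1 x * h (S x) \<partial>M) = (\<integral>x. h x \<partial>M)"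
    by (auto simp: has_bochner_integral_iff)
qed

text \<open>
  Garsia's proof of Hopf's maximal inequality; defining the running maxima by the recursion
  \<open>m (Suc n) = max 0 (g + w 1 * m n \<circ> S)\<close> makes it two lines.
\<close>

lemma maximal_inequality:
  assumes [measurable]: "u \<in> borel_measurable M"
    and u: "\<And>x. x \<in> space M \<Longrightarrow> 0 \<le> u x \<and> u x \<le> 1"
    and t: "0 < t"
  shows "t * prob {x\<in>space M. t * (\<Sum>k<N. w k x) < (\<Sum>k<N. w k x * u ((S ^^ k) x))} \<le> (\<integral>x. u x \<partial>M)"
proof -
  define g where "g x = u x - t" for x
  have [measurable]: "g \<in> borel_measurable M" unfolding g_def by measurable
  have u_int: "integrable M u"
    by (rule integrable_const_bound[where B = 1]) (use u in auto)
  then have g_int: "integrable M g" unfolding g_def by simp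
  define m where "m n = rec_nat (\<lambda>_. 0) (\<lambda>_ f x. max 0 (g x + w 1 x * f (S x))) n" for n :: nat
  have m_0: "m 0 x = 0" and m_Suc: "m (Suc n) x = max 0 (g x + w 1 x * m n (S x))" for n x
    by (simp_all add: m_def)
  have [measurable]: "m n \<in> borel_measurable M" for n
  proof (induction n)
    case (Suc n)
    then have [measurable]: "m n \<in> borel_measurable M" .
    have "m (Suc n) = (\<lambda>x. max 0 (g x + w 1 x * m n (S x)))" by (rule ext) (rule m_Suc)
    then show ?case by simp
  qed (simp add: m_def)
  have m_nonneg: "0 \<le> m n x" for n x by (cases n) (simp_all add: m_0 m_Suc)
  have m_mono: "m n x \<le> m (Suc n) x" if "x \<in> space M" for n x
    using that
  proof (induction n arbitrary: x)
    case (Suc n)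
    have "w 1 x * m n (S x) \<le> w 1 x * m (Suc n) (S x)"
      using Suc by (intro mult_left_mono) (auto simp: S_space w_pos less_imp_le)
    then show ?case unfolding m_Suc[of _ x] by linarith
  qed (simp add: m_0 m_nonneg)
  have m_int: "integrable M (m n)" for n
  proof (induction n)
    case (Suc n)
    have "integrable M (\<lambda>x. g x + w 1 x * m n (S x))"
      using g_int transfer_integrable(1)[OF Suc m_nonneg] by simp
    then have "integrable M (\<lambda>x. max 0 (g x + w 1 x * m n (S x)))" by simp
    then show ?case by (simp add: m_Suc[abs_def])
  qed (simp add: m_0[abs_def])
  define s where "s n x = (\<Sum>k<n. w k x * g ((S ^^ k) x))" for n x
  \<comment> \<open>The recursion for \<open>m\<close> holds at every point, that for the sums
    \<open>s\<close> only almost everywhere, so \<open>s\<close> enters only through this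
    comparison.\<close>
  have s_le_m: "AE x in M. s n x \<le> m n x" for n
  proof (induction n)
    case (Suc n)
    have "AE x in M. \<forall>k. w (Suc k) x = w 1 x * w k (S x)"
      unfolding AE_all_countable using cocycle by blast
    then show ?case using AE_shift[OF Suc] AE_space
    proof eventually_elim
      case (elim x)
      have "s (Suc n) x = g x + (\<Sum>k<n. w (Suc k) x * g ((S ^^ k) (S x)))"
        unfolding s_def by (subst sum.lessThan_Suc_shift) (simp add: w_0 elim(3) funpow_Suc_right del: funpow.simps(2))
      also have "\<dots> = g x + w 1 x * s n (S x)"
        unfolding s_def by (simp only: elim(1)[rule_format] sum_distrib_left mult.assoc)
      also have "\<dots> \<le> g x + w 1 x * m n (S x)"
        using elim(2) w_pos[OF elim(3), of 1] by (intro add_left_mono mult_left_mono) auto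
      finally show ?case by (simp add: m_Suc)
    qed
  qed (simp add: s_def m_0)
  define A where "A = {x\<in>space M. 0 < m (Suc N) x}"
  have [measurable]: "A \<in> sets M" unfolding A_def by measurable
  have gA: "integrable M (\<lambda>x. g x * indicator A x)"
    using integrable_real_mult_indicator[OF \<open>A \<in> sets M\<close> g_int] .
  \<comment> \<open>\<open>transfer\<close> rewrites the integral of \<open>m N\<close> as that of
    \<open>w 1 x * m N (S x)\<close>. On \<open>A\<close> the maximum in the recursion is attained
    by its second entry, so the difference with \<open>m (Suc N)\<close> is exactly
    \<open>g\<close>; off \<open>A\<close> it is at most 0.\<close>
  have "0 \<le> (\<integral>x. m (Suc N) x \<partial>M) - (\<integral>x. m N x \<partial>M)"
    using integral_mono[OF m_int m_int m_mono, of N] by simp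
  also have "\<dots> = (\<integral>x. m (Suc N) x - w 1 x * m N (S x) \<partial>M)"
    using transfer_integrable[OF m_int m_nonneg, of N] m_int by simp
  also have "\<dots> \<le> (\<integral>x. g x * indicator A x \<partial>M)"
  proof (rule integral_mono)
    show "integrable M (\<lambda>x. m (Suc N) x - w 1 x * m N (S x))"
      using transfer_integrable[OF m_int m_nonneg, of N] m_int by simp
    fix x assume x: "x \<in> space M"
    have "0 \<le> w 1 x * m N (S x)" using w_pos[OF x, of 1] m_nonneg by simp
    then show "m (Suc N) x - w 1 x * m N (S x) \<le> g x * indicator A x"
      using x m_Suc[of N x] m_nonneg[of "Suc N" x] by (auto simp: A_def indicator_def max_def split: if_splits)
  qed (rule gA)
  also have "\<dots> = (\<integral>x. u x * indicator A x - t * indicator A x \<partial>M)"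
    by (simp add: g_def left_diff_distrib)
  also have "\<dots> = (\<integral>x. u x * indicator A x \<partial>M) - t * prob A"
    using integrable_real_mult_indicator[OF \<open>A \<in> sets M\<close> u_int] integrable_real_mult_indicator[OF \<open>A \<in> sets M\<close>, of "\<lambda>_. 1"]
    by (subst Bochner_Integration.integral_diff) auto
  also have "(\<integral>x. u x * indicator A x \<partial>M) \<le> (\<integral>x. u x \<partial>M)"
    by (rule integral_mono)
       (use u u_int integrable_real_mult_indicator[OF \<open>A \<in> sets M\<close> u_int] in \<open>auto simp: indicator_def\<close>)
  finally have *: "t * prob A \<le> (\<integral>x. u x \<partial>M)" by simp
  have "prob {x\<in>space M. t * (\<Sum>k<N. w k x) < (\<Sum>k<N. w k x * u ((S ^^ k) x))} \<le> prob A"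
  proof (rule finite_measure_mono_AE)
    show "AE x in M. x \<in> {x\<in>space M. t * (\<Sum>k<N. w k x) < (\<Sum>k<N. w k x * u ((S ^^ k) x))} \<longrightarrow> x \<in> A"
      using s_le_m[of N] AE_space
    proof eventually_elim
      case (elim x)
      have "s N x = (\<Sum>k<N. w k x * u ((S ^^ k) x)) - t * (\<Sum>k<N. w k x)"
        by (simp add: s_def g_def right_diff_distrib sum_subtractf sum_distrib_left mult.commute)
      then show ?case using elim m_mono[of x N] by (auto simp: A_def)
    qed
  qed simp
  then have "t * prob {x\<in>space M. t * (\<Sum>k<N. w k x) < (\<Sum>k<N. w k x * u ((S ^^ k) x))} \<le> t * prob A"
    using t by simp
  with * show ?thesis by linarith
qed

section \<open>Weighted ergodic averages and conservativity\<close>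

definition ratio :: "('a \<Rightarrow> real) \<Rightarrow> nat \<Rightarrow> 'a \<Rightarrow> real" where
  "ratio F N x = (\<Sum>k<N. w k x * F ((S ^^ k) x)) / (\<Sum>k<N. w k x)"

lemma ratio_meas [measurable]:
  assumes [measurable]: "F \<in> borel_measurable M"
  shows "ratio F N \<in> borel_measurable M"
proof -
  have [measurable]: "(\<lambda>x. F ((S ^^ k) x)) \<in> borel_measurable M" for k
    by (rule measurable_compose[OF funpow_S_meas]) measurable
  show ?thesis unfolding ratio_def by measurable
qed

text \<open>Membership in \<open>E\<close> is constant along almost every orbit, so the indicator of
  \<open>E\<close> is its own weighted average. The error is thus dominated by the average of the
  difference of the two indicators, to which the maximal inequality applies with a bound free of
  \<open>N\<close>.\<close>

lemma ratio_invariant_approx: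
  assumes [measurable]: "E \<in> sets M" "C \<in> sets M"
    and inv: "AE x in M. S x \<in> E \<longleftrightarrow> x \<in> E"
    and t: "0 < t" and N: "0 < N"
  shows "t * prob {x\<in>space M. t < \<bar>ratio (indicator C) N x - indicator E x\<bar>} \<le> prob (sym_diff E C)"
proof -
  define u where "u x = \<bar>indicator C x - indicator E x :: real\<bar>" for x
  have [measurable]: "u \<in> borel_measurable M" unfolding u_def by measurable
  have inv_n: "AE x in M. (S ^^ n) x \<in> E \<longleftrightarrow> x \<in> E" for n
  proof (induction n)
    case (Suc n)
    show ?case using AE_shift[OF Suc] inv
      by eventually_elim (simp add: funpow_swap1)
  qed simp
  have [measurable]: "(\<lambda>x. u ((S ^^ k) x)) \<in> borel_measurable M" for k
    by (rule measurable_compose[OF funpow_S_meas]) measurable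
  let ?A = "{x\<in>space M. t * (\<Sum>k<N. w k x) < (\<Sum>k<N. w k x * u ((S ^^ k) x))}"
  have "prob {x\<in>space M. t < \<bar>ratio (indicator C) N x - indicator E x\<bar>} \<le> prob ?A"
  proof (rule finite_measure_mono_AE)
    have "AE x in M. \<forall>n. (S ^^ n) x \<in> E \<longleftrightarrow> x \<in> E" using inv_n by (simp add: AE_all_countable)
    then show "AE x in M. x \<in> {x\<in>space M. t < \<bar>ratio (indicator C) N x - indicator E x\<bar>} \<longrightarrow> x \<in> ?A"
      using AE_space
    proof eventually_elim
      case (elim x)
      let ?V = "\<Sum>k<N. w k x" and ?T = "\<Sum>k<N. w k x * indicator C ((S ^^ k) x)"
      have V: "0 < ?V" using N elim by (intro sum_pos) (auto simp: w_pos lessThan_empty_iff)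
      have "\<bar>?T - indicator E x * ?V\<bar> = \<bar>\<Sum>k<N. w k x * (indicator C ((S ^^ k) x) - indicator E x)\<bar>"
        by (simp only: right_diff_distrib sum_subtractf sum_distrib_left mult.commute)
      also have "\<dots> \<le> (\<Sum>k<N. w k x * u ((S ^^ k) x))"
        using elim w_pos[of x] by (intro order_trans[OF sum_abs] sum_mono) (auto simp: u_def abs_mult indicator_def less_imp_le)
      finally have le: "\<bar>?T - indicator E x * ?V\<bar> \<le> (\<Sum>k<N. w k x * u ((S ^^ k) x))" .
      have "ratio (indicator C) N x - indicator E x = (?T - indicator E x * ?V) / ?V"
        using V by (simp add: ratio_def diff_divide_distrib)
      then have "\<bar>ratio (indicator C) N x - indicator E x\<bar> = \<bar>?T - indicator E x * ?V\<bar> / ?V"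
        using V by (simp only: abs_divide abs_of_pos)
      then have "t < \<bar>ratio (indicator C) N x - indicator E x\<bar> \<Longrightarrow> t * ?V < \<bar>?T - indicator E x * ?V\<bar>"
        using V by (simp only: pos_less_divide_eq)
      then show ?case using elim le by (intro impI) (simp only: mem_Collect_eq, linarith)
    qed
  qed measurable
  then have "t * prob {x\<in>space M. t < \<bar>ratio (indicator C) N x - indicator E x\<bar>} \<le> t * prob ?A"
    using t by simp
  also have "\<dots> \<le> (\<integral>x. u x \<partial>M)"
    by (rule maximal_inequality) (use t in \<open>auto simp: u_def indicator_def\<close>)
  also have "(\<integral>x. u x \<partial>M) = (\<integral>x. indicator (sym_diff E C) x \<partial>M)"
    by (rule Bochner_Integration.integral_cong) (auto simp: u_def indicator_def)
  also have "\<dots> = prob (sym_diff E C)" by simp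
  finally show ?thesis .
qed

text \<open>On the set \<open>?Z\<close> where all sums stay below \<open>b\<close>, Cauchy-Schwarz
  forces the sum of the first \<open>N\<close> inverses to be at least \<open>N\<^sup>2 / b\<close>.
  Its integral is at most \<open>N * K * sqrt N\<close>, so \<open>?Z\<close> has measure at most
  \<open>b * K / sqrt N\<close> for every \<open>N\<close>.\<close>

lemma AE_conservative:
  assumes w_inv: "\<And>n. (\<integral>\<^sup>+x. ennreal (1 / w n x) \<partial>M) \<le> ennreal (K * sqrt (real (Suc n)))"
    and K: "0 \<le> K"
  shows "AE x in M. filterlim (\<lambda>N. \<Sum>k<N. w k x) at_top sequentially"
proof -
  have "AE x in M. \<exists>N. real b < (\<Sum>k<N. w k x)" for b :: nat
  proof -
    let ?Z = "{x\<in>space M. \<forall>N. (\<Sum>k<N. w k x) \<le> real b}"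
    have [measurable]: "?Z \<in> sets M" by measurable
    have le: "prob ?Z \<le> b * K / sqrt (real N)" if N: "0 < N" for N
    proof -
      have "ennreal ((real N)\<^sup>2 * prob ?Z) = (\<integral>\<^sup>+x. ennreal ((real N)\<^sup>2) * indicator ?Z x \<partial>M)"
        by (simp add: nn_integral_cmult_indicator emeasure_eq_measure ennreal_mult)
      also have "\<dots> \<le> (\<integral>\<^sup>+x. ennreal b * (\<Sum>k<N. ennreal (1 / w k x)) \<partial>M)"
      proof (rule nn_integral_mono)
        fix x assume x: "x \<in> space M"
        have "(real N)\<^sup>2 \<le> b * (\<Sum>k<N. 1 / w k x)" if "x \<in> ?Z"
        proof -
          have "(real N)\<^sup>2 = (\<Sum>k<N. sqrt (w k x) * sqrt (1 / w k x))\<^sup>2"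
            using w_pos[OF x] by (simp add: real_sqrt_mult[symmetric] less_imp_neq[symmetric])
          also have "\<dots> \<le> (\<Sum>k<N. (sqrt (w k x))\<^sup>2) * (\<Sum>k<N. (sqrt (1 / w k x))\<^sup>2)"
            by (rule Cauchy_Schwarz_ineq_sum)
          also have "\<dots> = (\<Sum>k<N. w k x) * (\<Sum>k<N. 1 / w k x)"
            using w_pos[OF x] by (simp add: less_imp_le)
          also have "\<dots> \<le> b * (\<Sum>k<N. 1 / w k x)"
            using that w_pos[OF x] by (intro mult_right_mono sum_nonneg) (auto simp: less_imp_le)
          finally show ?thesis .
        qed
        then show "ennreal ((real N)\<^sup>2) * indicator ?Z x \<le> ennreal b * (\<Sum>k<N. ennreal (1 / w k x))"
          using w_pos[OF x]
          by (cases "x \<in> ?Z")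
             (simp_all add: sum_ennreal ennreal_mult[symmetric] sum_nonneg less_imp_le ennreal_leI del: mem_Collect_eq)
      qed
      also have "\<dots> = ennreal b * (\<Sum>k<N. \<integral>\<^sup>+x. ennreal (1 / w k x) \<partial>M)"
        by (subst nn_integral_cmult) (auto simp: nn_integral_sum)
      also have "\<dots> \<le> ennreal b * (\<Sum>k<N. ennreal (K * sqrt (real N)))"
      proof (intro mult_left_mono sum_mono)
        fix k assume "k \<in> {..<N}"
        then have "ennreal (K * sqrt (real (Suc k))) \<le> ennreal (K * sqrt (real N))"
          using K by (intro ennreal_leI mult_left_mono) auto
        then show "(\<integral>\<^sup>+x. ennreal (1 / w k x) \<partial>M) \<le> ennreal (K * sqrt (real N))"
          using w_inv[of k] order_trans by blast
      qed simp
      also have "\<dots> = ennreal (b * (real N * (K * sqrt (real N))))"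
        using K by (simp add: ennreal_mult ennreal_of_nat_eq_real_of_nat)
      finally have "(real N)\<^sup>2 * prob ?Z \<le> b * (real N * (K * sqrt (real N)))"
        using K by (subst (asm) ennreal_le_iff) auto
      then have "real N * (real N * prob ?Z) \<le> real N * (b * (K * sqrt (real N)))"
        by (simp add: power2_eq_square mult_ac)
      then have "real N * prob ?Z \<le> b * (K * sqrt (real N))"
        using N by (subst (asm) mult_le_cancel_left_pos) auto
      then have "sqrt (real N) * (sqrt (real N) * prob ?Z) \<le> sqrt (real N) * (b * K)"
        by (simp add: mult.assoc[symmetric]) (simp add: mult_ac)
      then have "sqrt (real N) * prob ?Z \<le> b * K"
        using N by (subst (asm) mult_le_cancel_left_pos) auto
      then show ?thesis using N by (simp add: field_simps)
    qed
    have "(\<lambda>N. b * K / sqrt (real N)) \<longlonglongrightarrow> 0" by real_asymp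
    then have "prob ?Z \<le> 0"
      by (rule tendsto_lowerbound) (use eventually_mono[OF eventually_gt_at_top[of 0] le] in simp_all)
    then have "prob ?Z = 0" by (intro antisym measure_nonneg)
    then have "AE x in M. x \<notin> ?Z"
      by (rule prob_eq_0[THEN iffD1, rotated]) measurable
    then show ?thesis using AE_space
    proof eventually_elim
      case (elim x)
      then have "\<not> (\<forall>N. (\<Sum>k<N. w k x) \<le> real b)" by blast
      then show ?case by (simp only: not_all not_le)
    qed
  qed
  then have "AE x in M. \<forall>b::nat. \<exists>N. real b < (\<Sum>k<N. w k x)"
    by (simp add: AE_all_countable)
  then show ?thesis using AE_space
  proof eventually_elim
    case (elim x)
    show ?case unfolding filterlim_at_top
    proof
      fix c :: real
      obtain b :: nat where b: "c < b" using reals_Archimedean2 by blast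
      then obtain N where N: "real b < (\<Sum>k<N. w k x)" using elim by blast
      have "c \<le> (\<Sum>k<n. w k x)" if "N \<le> n" for n
      proof -
        have "(\<Sum>k<N. w k x) \<le> (\<Sum>k<n. w k x)"
          using that elim w_pos[of x] by (intro sum_mono2) (auto simp: less_imp_le)
        then show ?thesis using b N by linarith
      qed
      then show "\<forall>\<^sub>F n in sequentially. c \<le> (\<Sum>k<n. w k x)"
        unfolding eventually_sequentially by blast
    qed
  qed
qed

end

section \<open>Permutations of the coordinates\<close>

text \<open>From \<open>n0\<close> on, the two numerators and the two denominators are related by
  the factor \<open>\<rho>\<close> up to constants \<open>d\<close> and \<open>c\<close>. The
  constants are lost on division by the diverging denominator.\<close>

lemma ratio_diff_tendsto_0:
  fixes a b h h' :: "nat \<Rightarrow> real"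
  assumes pos: "\<And>n. 0 < a n" "\<And>n. 0 < b n" and h: "\<And>n. \<bar>h n\<bar> \<le> 1"
    and eq: "\<And>n. n0 \<le> n \<Longrightarrow> b n = \<rho> * a n" "\<And>n. n0 \<le> n \<Longrightarrow> h' n = h n"
    and lim: "filterlim (\<lambda>N. \<Sum>k<N. a k) at_top sequentially"
  shows "(\<lambda>N. (\<Sum>k<N. a k * h k) / (\<Sum>k<N. a k) - (\<Sum>k<N. b k * h' k) / (\<Sum>k<N. b k)) \<longlonglongrightarrow> 0"
proof -
  define A B T U where "A N = (\<Sum>k<N. a k)" and "B N = (\<Sum>k<N. b k)"
    and "T N = (\<Sum>k<N. a k * h k)" and "U N = (\<Sum>k<N. b k * h' k)" for N
  have rho: "0 < \<rho>" using pos eq(1)[of n0] by (metis order_refl zero_less_mult_pos2)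
  define c d where "c = B n0 - \<rho> * A n0" and "d = U n0 - \<rho> * T n0"
  have BU: "B N = \<rho> * A N + c \<and> U N = \<rho> * T N + d" if "n0 \<le> N" for N
    using that
  proof (induction rule: dec_induct)
    case (step N)
    then show ?case using eq[of N] by (simp add: A_def B_def T_def U_def algebra_simps)
  qed (simp add: c_def d_def)
  have B_lim: "filterlim B at_top sequentially"
  proof -
    have "filterlim (\<lambda>N. c + \<rho> * A N) at_top sequentially"
      using filterlim_tendsto_pos_mult_at_top[OF tendsto_const rho, of A] lim
      by (intro filterlim_tendsto_add_at_top[OF tendsto_const]) (auto simp: A_def)
    moreover have "\<forall>\<^sub>F N in sequentially. c + \<rho> * A N = B N"
      using eventually_ge_at_top[of n0] by eventually_elim (simp add: BU)
    ultimately show ?thesis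
      by (rule filterlim_mono_eventually[OF _ order_refl order_refl])
  qed
  have "(\<lambda>N. T N / A N - U N / B N) \<longlonglongrightarrow> 0"
  proof (rule Lim_null_comparison)
    show "(\<lambda>N. (\<bar>c\<bar> + \<bar>d\<bar>) / B N) \<longlonglongrightarrow> 0"
      using B_lim by (rule real_tendsto_divide_at_top[OF tendsto_const])
    show "\<forall>\<^sub>F N in sequentially. norm (T N / A N - U N / B N) \<le> (\<bar>c\<bar> + \<bar>d\<bar>) / B N"
      using eventually_gt_at_top[of n0]
    proof eventually_elim
      case (elim N)
      have AB: "0 < A N" "0 < B N"
        using elim pos unfolding A_def B_def by (auto intro!: sum_pos simp: lessThan_empty_iff)
      have TA: "\<bar>T N\<bar> \<le> A N"
        unfolding T_def A_def
        by (intro order_trans[OF sum_abs] sum_mono) (use h pos in \<open>auto simp: abs_mult abs_of_pos intro: mult_left_le less_imp_le\<close>)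
      \<comment> \<open>Over the common denominator the terms with \<open>\<rho>\<close> cancel.
        Keeping \<open>T N / A N\<close> as a unit, which is bounded by 1, leaves only
        \<open>B N\<close> to divide by.\<close>
      have "T N / A N - U N / B N = (c * (T N / A N) - d) / B N"
        using BU[of N] elim AB by (simp add: field_simps)
      also have "\<bar>\<dots>\<bar> \<le> (\<bar>c\<bar> + \<bar>d\<bar>) / B N"
      proof -
        have "\<bar>c * (T N / A N)\<bar> \<le> \<bar>c\<bar> * 1"
          unfolding abs_mult using TA AB by (intro mult_left_mono) auto
        then have "\<bar>c * (T N / A N) - d\<bar> \<le> \<bar>c\<bar> + \<bar>d\<bar>" by linarith
        then show ?thesis using AB by (simp add: divide_right_mono)
      qed
      finally show ?case by simp
    qed
  qed
  then show ?thesis by (simp add: A_def B_def T_def U_def)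
qed

text \<open>\<open>K\<close> is the growth condition behind conservativity. The last two conditions
  serve resampling: by \<open>escape\<close>, the iterates eventually read a finite set of
  coordinates from positions outside it; by \<open>eventually_one\<close>, the numerator of a fixed
  coordinate's factor in \<open>W\<close> is eventually 1, so that replacing the coordinate changes
  \<open>W\<close> by a factor that no longer depends on time.\<close>

locale permutation_shift = density_family L \<phi> e lo hi
  for L :: "'a measure" and \<phi> :: "'i \<Rightarrow> 'a \<Rightarrow> real" and e lo hi +
  fixes \<sigma> \<tau> :: "'i \<Rightarrow> 'i" and D :: "nat \<Rightarrow> real" and K :: real
  assumes sigma_tau [simp]: "\<And>p. \<sigma> (\<tau> p) = p" and tau_sigma [simp]: "\<And>p. \<tau> (\<sigma> p) = p"
    and D: "\<And>n F. finite F \<Longrightarrow> (\<Sum>p\<in>F. dist_mass (\<tau> ^^ n) p) \<le> D n"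
    and K: "\<And>n. exp (hi\<^sup>2 / lo * D n) \<le> K * sqrt (real (Suc n))"
    and escape: "\<And>p q. \<forall>\<^sub>F n in sequentially. (\<sigma> ^^ n) p \<noteq> q"
    and eventually_one: "\<And>p. AE u in L. \<forall>\<^sub>F n in sequentially. \<phi> ((\<tau> ^^ n) p) u = 1"
begin

definition S :: "('i \<Rightarrow> 'a) \<Rightarrow> 'i \<Rightarrow> 'a" where
  "S y = (\<lambda>p. y (\<sigma> p))"

lemma measurable_Y_iff:
  assumes "\<And>p. (\<lambda>x. f x p) \<in> measurable N L"
  shows "f \<in> measurable N Y"
  unfolding measurable_cong_sets[OF refl sets_Y]
  by (rule measurable_PiM_single') (use assms measurable_space[OF assms] in auto)

lemma S_meas [measurable]: "S \<in> measurable Y Y"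
  unfolding S_def by (rule measurable_Y_iff) measurable

lemma funpow_S: "(S ^^ n) y = (\<lambda>p. y ((\<sigma> ^^ n) p))"
  by (induction n arbitrary: y) (simp_all add: S_def funpow_swap1)

text \<open>Coordinate \<open>p\<close> of \<open>S y\<close> is coordinate
  \<open>\<sigma> p\<close> of \<open>y\<close>, whose law under the permuted product is
  \<open>P (\<tau> (\<sigma> p)) = P p\<close>. Combined with \<open>density_W\<close>, this is the
  transfer identity.\<close>

lemma distr_S: "distr (Pi\<^sub>M UNIV (\<lambda>p. P (\<tau> p))) Y S = Y"
proof -
  have "inj \<sigma>" by (metis injI tau_sigma)
  then have "distr (Pi\<^sub>M UNIV (\<lambda>p. P (\<tau> p))) (Pi\<^sub>M UNIV (\<lambda>p. P (\<tau> (\<sigma> p)))) (\<lambda>y. \<lambda>p\<in>UNIV. y (\<sigma> p))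
     = Pi\<^sub>M UNIV (\<lambda>p. P (\<tau> (\<sigma> p)))"
    by (intro distr_PiM_reindex prob_space_P) auto
  then show ?thesis by (simp add: Y_def S_def[abs_def] restrict_UNIV)
qed

text \<open>Substituting \<open>p = \<tau> q\<close> turns the factors of
  \<open>W (\<tau> ^^ n) (S y)\<close> into ratios of \<open>\<phi> ((\<tau> ^^ Suc n) q)\<close> to
  \<open>\<phi> (\<tau> q)\<close> at \<open>y q\<close>, which chain with the factors of
  \<open>W \<tau> y\<close>. The finite set \<open>F\<close> serves all three products.\<close>

lemma cocycle_finite:
  assumes y: "y \<in> space Y" and fin: "finite (chg \<tau> y)" "finite (chg (\<tau> ^^ Suc n) y)"
  shows "W (\<tau> ^^ Suc n) y = W \<tau> y * W (\<tau> ^^ n) (S y)"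
proof -
  define F where "F = chg \<tau> y \<union> chg (\<tau> ^^ Suc n) y"
  have F: "finite F" using fin by (simp add: F_def)
  have Sy: "S y \<in> space Y" using measurable_space[OF S_meas y] .
  have inj: "inj_on \<tau> F" by (metis inj_on_def sigma_tau)
  have "chg (\<tau> ^^ n) (S y) \<subseteq> \<tau> ` F"
  proof
    fix p assume "p \<in> chg (\<tau> ^^ n) (S y)"
    then have "\<phi> ((\<tau> ^^ Suc n) (\<sigma> p)) (y (\<sigma> p)) \<noteq> \<phi> (\<tau> (\<sigma> p)) (y (\<sigma> p))"
      by (simp add: chg_def S_def funpow_Suc_right del: funpow.simps(2))
    then have "\<sigma> p \<in> F" by (auto simp: F_def chg_def)
    then show "p \<in> \<tau> ` F" by (metis imageI tau_sigma)
  qed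
  then have "W (\<tau> ^^ n) (S y) = (\<Prod>p\<in>\<tau> ` F. \<phi> ((\<tau> ^^ n) p) (S y p) / \<phi> p (S y p))"
    using W_superset[OF Sy] F by blast
  also have "\<dots> = (\<Prod>q\<in>F. \<phi> ((\<tau> ^^ Suc n) q) (y q) / \<phi> (\<tau> q) (y q))"
    using inj by (simp add: prod.reindex S_def funpow_Suc_right del: funpow.simps(2))
  finally have "W \<tau> y * W (\<tau> ^^ n) (S y)
     = (\<Prod>q\<in>F. \<phi> (\<tau> q) (y q) / \<phi> q (y q)) * (\<Prod>q\<in>F. \<phi> ((\<tau> ^^ Suc n) q) (y q) / \<phi> (\<tau> q) (y q))"
    using W_superset[OF y F, of \<tau>] by (simp add: F_def)
  also have "\<dots> = (\<Prod>q\<in>F. \<phi> ((\<tau> ^^ Suc n) q) (y q) / \<phi> q (y q))"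
    unfolding prod.distrib[symmetric]
    by (rule prod.cong) (use phi_pos y in \<open>auto simp: less_imp_neq[symmetric]\<close>)
  also have "\<dots> = W (\<tau> ^^ Suc n) y"
    using W_superset[OF y F, of "\<tau> ^^ Suc n"] by (simp add: F_def)
  finally show ?thesis ..
qed

lemma AE_finite_chg_all: "AE y in Y. \<forall>n. finite (chg (\<tau> ^^ n) y)"
  unfolding AE_all_countable using AE_finite_chg[OF D] by blast

sublocale nonsingular_cocycle Y S "\<lambda>n. W (\<tau> ^^ n)"
proof unfold_locales
  have t1: "\<tau> ^^ 1 = \<tau>" by simp
  show "W (\<tau> ^^ 0) y = 1" for y by (simp add: W_def chg_def)
  show "(\<integral>\<^sup>+y. ennreal (W (\<tau> ^^ 1) y) * g (S y) \<partial>Y) = (\<integral>\<^sup>+y. g y \<partial>Y)"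
    if [measurable]: "g \<in> borel_measurable Y" for g
  proof -
    have D1: "(\<Sum>p\<in>F. dist_mass \<tau> p) \<le> D 1" if "finite F" for F using D[OF that, of 1] by simp
    have "(\<integral>\<^sup>+y. ennreal (W (\<tau> ^^ 1) y) * g (S y) \<partial>Y) = (\<integral>\<^sup>+y. g (S y) \<partial>density Y (\<lambda>y. ennreal (W \<tau> y)))"
      unfolding t1 by (rule nn_integral_density[symmetric]) measurable
    also have "\<dots> = (\<integral>\<^sup>+y. g (S y) \<partial>Pi\<^sub>M UNIV (\<lambda>p. P (\<tau> p)))"
      using density_W[OF D1] by simp
    also have "\<dots> = (\<integral>\<^sup>+y. g y \<partial>distr (Pi\<^sub>M UNIV (\<lambda>p. P (\<tau> p))) Y S)"
    proof (rule nn_integral_distr[symmetric])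
      have eq: "sets (Pi\<^sub>M UNIV (\<lambda>p. P (\<tau> p))) = sets Y"
        unfolding sets_Y by (rule sets_PiM_cong) auto
      show "S \<in> measurable (Pi\<^sub>M UNIV (\<lambda>p. P (\<tau> p))) Y"
        unfolding measurable_cong_sets[OF eq refl] by (rule S_meas)
      show "g \<in> borel_measurable (distr (Pi\<^sub>M UNIV (\<lambda>p. P (\<tau> p))) Y S)"
        unfolding measurable_distr_eq1 by fact
    qed
    finally show ?thesis unfolding distr_S .
  qed
  show "AE y in Y. W (\<tau> ^^ Suc n) y = W (\<tau> ^^ 1) y * W (\<tau> ^^ n) (S y)" for n
    using AE_finite_chg_all AE_space
  proof eventually_elim
    case (elim y)
    have "finite (chg \<tau> y)" using elim(1)[rule_format, of 1] by simp
    then show ?case unfolding t1 by (rule cocycle_finite[OF elim(2) _ elim(1)[rule_format]])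
  qed
qed (auto intro: W_pos)

lemma K_nonneg: "0 \<le> K"
  using K[of 0] exp_gt_zero[of "hi\<^sup>2 / lo * D 0"] by (simp del: exp_gt_zero)

lemma AE_sum_W_at_top: "AE y in Y. filterlim (\<lambda>N. \<Sum>k<N. W (\<tau> ^^ k) y) at_top sequentially"
proof (rule AE_conservative[OF _ K_nonneg])
  show "(\<integral>\<^sup>+y. ennreal (1 / W (\<tau> ^^ n) y) \<partial>Y) \<le> ennreal (K * sqrt (real (Suc n)))" for n
    using nn_integral_inverse_W[OF D, of n] ennreal_leI[OF K[of n]] by (rule order_trans)
qed

section \<open>Approximation by sets depending on finitely many coordinates\<close>

definition depends_on :: "('i \<Rightarrow> 'a) set \<Rightarrow> 'i set \<Rightarrow> bool" where
  "depends_on C F \<longleftrightarrow> (\<forall>y\<in>space Y. \<forall>z\<in>space Y. (\<forall>p\<in>F. y p = z p) \<longrightarrow> (y \<in> C \<longleftrightarrow> z \<in> C))"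

text \<open>Induction over the generated sigma-algebra: approximability passes to complements with
  the same error, and to countable unions by truncating the union first.\<close>

lemma cylinder_approx:
  assumes "E \<in> sets Y" "0 < \<epsilon>"
  shows "\<exists>C\<in>sets Y. \<exists>F. finite F \<and> depends_on C F \<and> measure Y (sym_diff E C) < \<epsilon>"
proof -
  have gen: "sets Y = sigma_sets (space Y) {{y\<in>space Y. y p \<in> A} | p A. A \<in> sets L}"
    unfolding sets_Y space_Y sets_PiM_single by (auto simp: PiE_def Pi_def intro!: arg_cong2[where f = sigma_sets])
  have "E \<in> sigma_sets (space Y) {{y\<in>space Y. y p \<in> A} | p A. A \<in> sets L}"
    using assms(1) unfolding gen .
  then show ?thesis using \<open>0 < \<epsilon>\<close>
  proof (induction arbitrary: \<epsilon> rule: sigma_sets.induct)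
    case (Basic E)
    then obtain p A where E: "E = {y\<in>space Y. y p \<in> A}" "A \<in> sets L" by auto
    then show ?case using Basic(2) sets_cylinder1
      by (intro bexI[of _ E] exI[of _ "{p}"]) (auto simp: depends_on_def)
  next
    case Empty
    then show ?case by (intro bexI[of _ "{}"] exI[of _ "{}"]) (auto simp: depends_on_def)
  next
    case (Compl E)
    then obtain C F where C: "C \<in> sets Y" "finite F" "depends_on C F" "measure Y (sym_diff E C) < \<epsilon>" by blast
    have "E \<in> sets Y" using Compl(1) unfolding gen .
    then have "E \<subseteq> space Y" by (rule sets.sets_into_space)
    have eq: "sym_diff (space Y - E) (space Y - C) = sym_diff E C"
    proof (rule set_eqI)
      show "x \<in> sym_diff (space Y - E) (space Y - C) \<longleftrightarrow> x \<in> sym_diff E C" for x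
        using subsetD[OF \<open>E \<subseteq> space Y\<close>, of x] subsetD[OF sets.sets_into_space[OF C(1)], of x]
        unfolding Un_iff Diff_iff by argo
    qed
    have "depends_on (space Y - C) F" using C(3) unfolding depends_on_def Diff_iff by blast
    then show ?case using C(1,2,4) eq
      by (intro bexI[of _ "space Y - C"] exI[of _ F]) (simp_all only: sets.compl_sets simp_thms)
  next
    case (Union E)
    have [measurable]: "E i \<in> sets Y" for i using Union(1) unfolding gen .
    have "(\<lambda>n. measure Y (\<Union>i<n. E i)) \<longlonglongrightarrow> measure Y (\<Union>n. \<Union>i<n. E i)"
      by (rule Y.finite_Lim_measure_incseq) (auto simp: incseq_def intro: less_le_trans)
    moreover have U: "(\<Union>n. \<Union>i<n. E i) = (\<Union>i. E i)" by blast
    ultimately have "\<forall>\<^sub>F n in sequentially. measure Y (\<Union>i. E i) - \<epsilon> / 2 < measure Y (\<Union>i<n. E i)"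
      using Union(3) by (intro order_tendstoD) auto
    then obtain n where n: "measure Y (\<Union>i. E i) - \<epsilon> / 2 < measure Y (\<Union>i<n. E i)"
      by (auto simp: eventually_sequentially)
    \<comment> \<open>Half of the error went into the truncation and the other half is split among
      \<open>n\<close> sets; \<open>Suc n\<close> instead of \<open>n\<close> covers the empty
      truncation.\<close>
    have "\<exists>C F. C \<in> sets Y \<and> finite F \<and> depends_on C F \<and> measure Y (sym_diff (E i) C) < \<epsilon> / (2 * Suc n)" for i
      using Union(2)[of "\<epsilon> / (2 * Suc n)" i] Union(3) by auto
    then obtain C F where C: "\<And>i. C i \<in> sets Y" "\<And>i. finite (F i)" "\<And>i. depends_on (C i) (F i)"
      and err: "\<And>i. measure Y (sym_diff (E i) (C i)) < \<epsilon> / (2 * Suc n)" by metis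
    have [measurable]: "C i \<in> sets Y" for i by (rule C)
    have "measure Y (sym_diff (\<Union>i. E i) (\<Union>i<n. C i))
        \<le> measure Y (((\<Union>i. E i) - (\<Union>i<n. E i)) \<union> (\<Union>i<n. sym_diff (E i) (C i)))"
      by (intro Y.finite_measure_mono) auto
    also have "\<dots> \<le> measure Y ((\<Union>i. E i) - (\<Union>i<n. E i)) + measure Y (\<Union>i<n. sym_diff (E i) (C i))"
      by (intro measure_Un_le) auto
    also have "measure Y ((\<Union>i. E i) - (\<Union>i<n. E i)) < \<epsilon> / 2"
      using n by (subst Y.finite_measure_Diff) auto
    also have "measure Y (\<Union>i<n. sym_diff (E i) (C i)) \<le> (\<Sum>i<n. measure Y (sym_diff (E i) (C i)))"
      by (intro Y.finite_measure_subadditive_finite) auto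
    also have "\<dots> \<le> (\<Sum>i<n. \<epsilon> / (2 * Suc n))"
      by (intro sum_mono less_imp_le err)
    also have "\<dots> \<le> \<epsilon> / 2"
      using Union(3) by (simp add: field_simps)
    finally have "measure Y (sym_diff (\<Union>i. E i) (\<Union>i<n. C i)) < \<epsilon>" by simp
    moreover have "depends_on (\<Union>i<n. C i) (\<Union>i<n. F i)"
      unfolding depends_on_def
    proof (intro ballI impI)
      fix y z assume "y \<in> space Y" "z \<in> space Y" "\<forall>p\<in>(\<Union>i<n. F i). y p = z p"
      then have "y \<in> C i \<longleftrightarrow> z \<in> C i" if "i < n" for i
        using C(3)[of i] that unfolding depends_on_def by blast
      then show "y \<in> (\<Union>i<n. C i) \<longleftrightarrow> z \<in> (\<Union>i<n. C i)" by auto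
    qed
    ultimately show ?case using C(2)
      by (intro bexI[of _ "\<Union>i<n. C i"] exI[of _ "\<Union>i<n. F i"]) auto
  qed
qed

section \<open>Replacing finitely many coordinates by independent copies\<close>

definition resample :: "'i set \<Rightarrow> ('i \<Rightarrow> 'a) \<times> ('i \<Rightarrow> 'a) \<Rightarrow> 'i \<Rightarrow> 'a" where
  "resample F yz = (\<lambda>p. if p \<in> F then snd yz p else fst yz p)"

lemma resample_meas [measurable]: "resample F \<in> measurable (Y \<Otimes>\<^sub>M Y) Y"
  unfolding resample_def
proof (rule measurable_Y_iff)
  show "(\<lambda>yz. if p \<in> F then snd yz p else fst yz p) \<in> measurable (Y \<Otimes>\<^sub>M Y) L" for p
    by (cases "p \<in> F") simp_all
qed

lemma emeasure_Y_cylinder: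
  "finite F \<Longrightarrow> (\<And>p. p \<in> F \<Longrightarrow> A p \<in> sets L) \<Longrightarrow>
    emeasure Y {y\<in>space Y. \<forall>p\<in>F. y p \<in> A p} = (\<Prod>p\<in>F. emeasure (P p) (A p))"
  unfolding Y_def by (rule PP.emeasure_PiM_Collect) auto

text \<open>The preimage of a cylinder is a rectangle: the conditions outside \<open>G\<close> fall
  on the first point and those in \<open>G\<close> on the second. The cases of empty and full
  \<open>G\<close> also yield the laws of the two projections.\<close>

lemma distr_resample: "distr (Y \<Otimes>\<^sub>M Y) Y (resample G) = Y"
proof -
  have "Pi\<^sub>M UNIV P = distr (Y \<Otimes>\<^sub>M Y) Y (resample G)"
  proof (rule measure_eqI_PiM_infinite[OF refl])
    show "finite_measure (Pi\<^sub>M UNIV P)" using Y.finite_measure_axioms by (simp add: Y_def)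
    fix F A assume F: "finite F" "F \<subseteq> (UNIV :: 'i set)" and A: "\<And>p. p \<in> F \<Longrightarrow> A p \<in> sets (P p)"
    have A': "A p \<in> sets L" if "p \<in> F" for p using A[OF that] by simp
    let ?E = "\<lambda>F. {y\<in>space Y. \<forall>p\<in>F. y p \<in> A p}"
    have m: "?E F' \<in> sets Y" if "F' \<subseteq> F" for F'
      using that finite_subset[OF that F(1)] A' by (intro sets.sets_Collect_finite_All sets_cylinder1) auto
    have emb: "prod_emb UNIV P F (Pi\<^sub>E F A) = ?E F"
      unfolding prod_emb_def space_Y space_P by (rule set_eqI) (simp add: PiE_iff conj_commute)
    have "emeasure (distr (Y \<Otimes>\<^sub>M Y) Y (resample G)) (?E F)
      = emeasure (Y \<Otimes>\<^sub>M Y) (resample G -` ?E F \<inter> space (Y \<Otimes>\<^sub>M Y))"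
      using m by (intro emeasure_distr) auto
    also have "resample G -` ?E F \<inter> space (Y \<Otimes>\<^sub>M Y) = ?E (F - G) \<times> ?E (F \<inter> G)"
    proof -
      have *: "(\<forall>p\<in>F. resample G (y, z) p \<in> A p) \<longleftrightarrow> (\<forall>p\<in>F - G. y p \<in> A p) \<and> (\<forall>p\<in>F \<inter> G. z p \<in> A p)" for y z
        by (auto simp: resample_def)
      have **: "resample G (y, z) \<in> space Y" if "y \<in> space Y" "z \<in> space Y" for y z
        using that measurable_space[OF resample_meas] by (simp add: space_pair_measure)
      show ?thesis
      proof (rule set_eqI)
        fix yz :: "('i \<Rightarrow> 'a) \<times> ('i \<Rightarrow> 'a)"
        obtain y z where yz: "yz = (y, z)" by (cases yz)
        show "yz \<in> resample G -` ?E F \<inter> space (Y \<Otimes>\<^sub>M Y) \<longleftrightarrow> yz \<in> ?E (F - G) \<times> ?E (F \<inter> G)"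
          unfolding yz space_pair_measure vimage_eq mem_Collect_eq Int_iff mem_Sigma_iff * using ** by blast
      qed
    qed
    also have "emeasure (Y \<Otimes>\<^sub>M Y) \<dots> = emeasure Y (?E (F - G)) * emeasure Y (?E (F \<inter> G))"
      using m by (intro Y.emeasure_pair_measure_Times) auto
    also have "\<dots> = (\<Prod>p\<in>F - G. emeasure (P p) (A p)) * (\<Prod>p\<in>F \<inter> G. emeasure (P p) (A p))"
      using F A' by (subst (1 2) emeasure_Y_cylinder) auto
    also have "\<dots> = (\<Prod>p\<in>F. emeasure (P p) (A p))"
      using F(1) by (subst prod.union_disjoint[symmetric]) (auto intro: prod.cong)
    also have "\<dots> = emeasure Y (?E F)"
      using F A' by (simp add: emeasure_Y_cylinder)
    finally show "emeasure (Pi\<^sub>M UNIV P) (prod_emb UNIV P F (Pi\<^sub>E F A))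
       = emeasure (distr (Y \<Otimes>\<^sub>M Y) Y (resample G)) (prod_emb UNIV P F (Pi\<^sub>E F A))"
      unfolding emb by (simp add: Y_def)
  qed (simp_all add: Y_def)
  then show ?thesis by (simp add: Y_def)
qed

lemma AE_eventually_one:
  "AE y in Y. \<forall>\<^sub>F n in sequentially. \<phi> ((\<tau> ^^ n) p) (y p) = 1"
  unfolding Y_def
proof (rule PP.AE_component)
  show "AE u in P p. \<forall>\<^sub>F n in sequentially. \<phi> ((\<tau> ^^ n) p) u = 1"
    unfolding P_def using eventually_one[of p] by (subst AE_density, simp) (erule eventually_mono, rule impI)
qed simp

lemma distr_fst: "distr (Y \<Otimes>\<^sub>M Y) Y fst = Y" and distr_snd: "distr (Y \<Otimes>\<^sub>M Y) Y snd = Y"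
proof -
  have "resample {} = fst" "resample UNIV = snd" by (simp_all add: resample_def fun_eq_iff)
  then show "distr (Y \<Otimes>\<^sub>M Y) Y fst = Y" "distr (Y \<Otimes>\<^sub>M Y) Y snd = Y"
    by (metis distr_resample)+
qed

lemma AE_fst: "AE y in Y. Q y \<Longrightarrow> AE yz in Y \<Otimes>\<^sub>M Y. Q (fst yz)"
  by (rule AE_distrD[of fst "Y \<Otimes>\<^sub>M Y" Y Q, OF measurable_fst]) (unfold distr_fst)

lemma AE_snd: "AE y in Y. Q y \<Longrightarrow> AE yz in Y \<Otimes>\<^sub>M Y. Q (snd yz)"
  by (rule AE_distrD[of snd "Y \<Otimes>\<^sub>M Y" Y Q, OF measurable_snd]) (unfold distr_snd)

lemma resample_space: "y \<in> space Y \<Longrightarrow> z \<in> space Y \<Longrightarrow> resample F (y, z) \<in> space Y"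
  by (simp add: space_Y resample_def del: space_YD)

text \<open>When the numerators over \<open>F\<close> are 1 at both points, each factor over
  \<open>F\<close> is just the inverse of the old density, \<open>\<phi> p (y p)\<close> or
  \<open>\<phi> p (z p)\<close>. All other factors agree, so the quotient of the two derivatives
  does not involve \<open>n\<close>.\<close>

lemma W_resample:
  assumes y: "y \<in> space Y" and z: "z \<in> space Y" and F: "finite F" and fin: "finite (chg (\<tau> ^^ n) y)"
    and one: "\<And>p. p \<in> F \<Longrightarrow> \<phi> ((\<tau> ^^ n) p) (y p) = 1" "\<And>p. p \<in> F \<Longrightarrow> \<phi> ((\<tau> ^^ n) p) (z p) = 1"
  shows "W (\<tau> ^^ n) (resample F (y, z)) = (\<Prod>p\<in>F. \<phi> p (y p) / \<phi> p (z p)) * W (\<tau> ^^ n) y"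
proof -
  let ?y' = "resample F (y, z)" and ?G = "chg (\<tau> ^^ n) y - F"
  let ?r = "\<lambda>y p. \<phi> ((\<tau> ^^ n) p) (y p) / \<phi> p (y p)"
  have y': "?y' \<in> space Y" using y z by (simp add: space_Y resample_def del: space_YD)
  have G: "finite (?G \<union> F)" "?G \<inter> F = {}" using F fin by auto
  have "W (\<tau> ^^ n) ?y' = prod (?r ?y') (?G \<union> F)"
    by (rule W_superset[OF y' G(1)]) (auto simp: chg_def resample_def)
  also have "\<dots> = prod (?r ?y') ?G * prod (?r ?y') F"
    using F fin by (intro prod.union_disjoint) (rule finite_Diff | blast)+
  also have "prod (?r ?y') ?G = prod (?r y) ?G"
    by (rule prod.cong) (auto simp: resample_def)
  also have "prod (?r ?y') F = (\<Prod>p\<in>F. \<phi> p (y p) / \<phi> p (z p)) * prod (?r y) F"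
    unfolding prod.distrib[symmetric]
  proof (rule prod.cong[OF refl])
    fix p assume "p \<in> F"
    then show "?r ?y' p = \<phi> p (y p) / \<phi> p (z p) * ?r y p"
      using one[of p] phi_pos[of "y p" p] y by (simp add: resample_def)
  qed
  also have "prod (?r y) ?G * ((\<Prod>p\<in>F. \<phi> p (y p) / \<phi> p (z p)) * prod (?r y) F)
     = (\<Prod>p\<in>F. \<phi> p (y p) / \<phi> p (z p)) * prod (?r y) (?G \<union> F)"
  proof -
    have "prod (?r y) (?G \<union> F) = prod (?r y) ?G * prod (?r y) F"
      using F fin by (intro prod.union_disjoint) (rule finite_Diff | blast)+
    then show ?thesis by (simp only: mult.left_commute)
  qed
  also have "prod (?r y) (?G \<union> F) = W (\<tau> ^^ n) y"
    by (rule W_superset[OF y G(1), symmetric]) blast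
  finally show ?thesis .
qed

text \<open>On \<open>F\<close> the iterate reads the coordinates \<open>(\<sigma> ^^ n) p\<close>,
  which lie outside \<open>F\<close> and were not replaced.\<close>

lemma indicator_resample:
  assumes y: "y \<in> space Y" and z: "z \<in> space Y" and C: "depends_on C F"
    and esc: "\<And>p. p \<in> F \<Longrightarrow> (\<sigma> ^^ n) p \<notin> F"
  shows "indicator C ((S ^^ n) (resample F (y, z))) = (indicator C ((S ^^ n) y) :: real)"
proof -
  have "(S ^^ n) (resample F (y, z)) p = (S ^^ n) y p" if "p \<in> F" for p
    using esc[OF that] by (simp add: funpow_S resample_def)
  moreover have "(S ^^ n) (resample F (y, z)) \<in> space Y" "(S ^^ n) y \<in> space Y"
    using y z by (simp_all add: funpow_S space_Y resample_def del: space_YD)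
  ultimately have "(S ^^ n) (resample F (y, z)) \<in> C \<longleftrightarrow> (S ^^ n) y \<in> C"
    using C unfolding depends_on_def by blast
  then show ?thesis by (simp add: indicator_def)
qed

text \<open>For almost every pair there is a time, depending on the pair, after which weights and
  indicators along the two orbits are related as in \<open>ratio_diff_tendsto_0\<close>;
  conservativity at the first point provides the divergence.\<close>

lemma AE_ratio_resample:
  assumes F: "finite F" and C: "depends_on C F"
  shows "AE yz in Y \<Otimes>\<^sub>M Y.
    (\<lambda>N. ratio (indicator C) N (fst yz) - ratio (indicator C) N (resample F yz)) \<longlonglongrightarrow> 0"
proof -
  have one: "AE y in Y. \<forall>p\<in>F. \<forall>\<^sub>F n in sequentially. \<phi> ((\<tau> ^^ n) p) (y p) = 1"
    by (rule AE_finite_allI[OF F]) (rule AE_eventually_one)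
  show ?thesis
    using AE_fst[OF one] AE_snd[OF one] AE_fst[OF AE_finite_chg_all] AE_fst[OF AE_sum_W_at_top] AE_space
  proof eventually_elim
    case (elim yz)
    obtain y z where yz: "yz = (y, z)" by (cases yz)
    have sp: "y \<in> space Y" "z \<in> space Y" using elim(5) by (auto simp: yz space_pair_measure)
    have "\<forall>\<^sub>F n in sequentially. \<forall>p\<in>F. \<forall>q\<in>F. (\<sigma> ^^ n) p \<noteq> q"
      using F escape by (intro eventually_ball_finite ballI) auto
    moreover have "\<forall>\<^sub>F n in sequentially. \<forall>p\<in>F. \<phi> ((\<tau> ^^ n) p) (y p) = 1"
      "\<forall>\<^sub>F n in sequentially. \<forall>p\<in>F. \<phi> ((\<tau> ^^ n) p) (z p) = 1"
      using F elim(1,2) by (auto simp: yz intro!: eventually_ball_finite)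
    ultimately have "\<forall>\<^sub>F n in sequentially. (\<forall>p\<in>F. \<forall>q\<in>F. (\<sigma> ^^ n) p \<noteq> q) \<and>
       (\<forall>p\<in>F. \<phi> ((\<tau> ^^ n) p) (y p) = 1) \<and> (\<forall>p\<in>F. \<phi> ((\<tau> ^^ n) p) (z p) = 1)"
      by (intro eventually_conj)
    then obtain n0 where n0: "\<And>n. n0 \<le> n \<Longrightarrow> (\<forall>p\<in>F. \<forall>q\<in>F. (\<sigma> ^^ n) p \<noteq> q) \<and>
       (\<forall>p\<in>F. \<phi> ((\<tau> ^^ n) p) (y p) = 1) \<and> (\<forall>p\<in>F. \<phi> ((\<tau> ^^ n) p) (z p) = 1)"
      unfolding eventually_sequentially by blast
    have y': "resample F (y, z) \<in> space Y" using sp by (rule resample_space)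
    have lim: "filterlim (\<lambda>N. \<Sum>k<N. W (\<tau> ^^ k) y) at_top sequentially"
      using elim(4) unfolding yz fst_conv .
    have fin: "\<And>n. finite (chg (\<tau> ^^ n) y)" using elim(3) unfolding yz fst_conv by (rule spec)
    show ?case unfolding ratio_def yz fst_conv
    proof (rule ratio_diff_tendsto_0)
      show "0 < W (\<tau> ^^ n) y" "0 < W (\<tau> ^^ n) (resample F (y, z))" for n
        by (rule W_pos[OF sp(1)], rule W_pos[OF y'])
      show "\<bar>indicator C ((S ^^ n) y) :: real\<bar> \<le> 1" for n by (simp add: indicator_def)
      show "filterlim (\<lambda>N. \<Sum>k<N. W (\<tau> ^^ k) y) at_top sequentially"
        by (rule lim)
      show "W (\<tau> ^^ n) (resample F (y, z)) = (\<Prod>p\<in>F. \<phi> p (y p) / \<phi> p (z p)) * W (\<tau> ^^ n) y"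
        if "n0 \<le> n" for n
        using n0[OF that] by (intro W_resample sp F fin) blast+
      show "indicator C ((S ^^ n) (resample F (y, z))) = (indicator C ((S ^^ n) y) :: real)" if "n0 \<le> n" for n
        using n0[OF that] by (intro indicator_resample sp C) blast
    qed
  qed
qed

text \<open>
  Resampling the coordinates of \<open>y\<close> on which a cylinder approximation \<open>C\<close> of \<open>E\<close> depends
  hardly changes the averages of the indicator of \<open>C\<close>, hence hardly changes membership in \<open>E\<close>;
  but the resampled point lies in \<open>E\<close> essentially iff the independent point \<open>z\<close> does.
\<close>

theorem invariant_trivial:
  assumes E [measurable]: "E \<in> sets Y" and inv: "AE y in Y. S y \<in> E \<longleftrightarrow> y \<in> E"
  shows "emeasure Y E = 0 \<or> emeasure Y (space Y - E) = 0"
proof -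
  let ?YY = "Y \<Otimes>\<^sub>M Y"
  have bound: "measure Y E * measure Y (space Y - E) \<le> 10 * \<epsilon>" if eps: "0 < \<epsilon>" for \<epsilon>
  proof -
    obtain C F where C [measurable]: "C \<in> sets Y" and F: "finite F" "depends_on C F"
      and err: "measure Y (sym_diff E C) < \<epsilon>"
      using cylinder_approx[OF E eps] by blast
    \<comment> \<open>The threshold 1/4: if exactly one of two points is in \<open>E\<close> while
      their averages differ by less than 1/2, one of the averages misses its indicator by more than
      1/4. The maximal inequality then costs a factor 4.\<close>
    define B where "B N = {y\<in>space Y. 1/4 < \<bar>ratio (indicator C) N y - indicator E y\<bar>}" for N
    have [measurable]: "B N \<in> sets Y" for N unfolding B_def by measurable
    have B: "emeasure Y (B N) \<le> ennreal (4 * \<epsilon>)" if "0 < N" for N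
    proof -
      have "1/4 * measure Y (B N) \<le> measure Y (sym_diff E C)"
        unfolding B_def by (rule ratio_invariant_approx) (use inv that in auto)
      then show ?thesis using err by (simp add: Y.emeasure_eq_measure ennreal_leI)
    qed
    define X where "X = {yz\<in>space ?YY. fst yz \<in> E \<longleftrightarrow> resample F yz \<notin> E}"
    define Z where "Z N = (fst -` B N \<inter> space ?YY) \<union> (resample F -` B N \<inter> space ?YY)" for N
    have [measurable]: "X \<in> sets ?YY" "Z N \<in> sets ?YY" for N unfolding X_def Z_def by measurable
    have Z: "emeasure ?YY (Z N) \<le> ennreal (8 * \<epsilon>)" if "0 < N" for N
    proof -
      have "emeasure ?YY (Z N) \<le> emeasure ?YY (fst -` B N \<inter> space ?YY) + emeasure ?YY (resample F -` B N \<inter> space ?YY)"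
        unfolding Z_def by (rule emeasure_subadditive) measurable
      also have "emeasure ?YY (fst -` B N \<inter> space ?YY) = emeasure (distr ?YY Y fst) (B N)"
        by (rule emeasure_distr[symmetric]) measurable
      also have "\<dots> = emeasure Y (B N)" by (simp add: distr_fst)
      also have "emeasure ?YY (resample F -` B N \<inter> space ?YY) = emeasure (distr ?YY Y (resample F)) (B N)"
        by (rule emeasure_distr[symmetric]) measurable
      also have "\<dots> = emeasure Y (B N)" by (simp add: distr_resample)
      also have "emeasure Y (B N) + emeasure Y (B N) \<le> ennreal (4 * \<epsilon>) + ennreal (4 * \<epsilon>)"
        by (intro add_mono B that)
      finally show ?thesis using eps by (simp flip: ennreal_plus)
    qed
    \<comment> \<open>Almost every pair of \<open>X\<close> lies in \<open>Z N\<close> from some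
      \<open>N\<close> on that depends on the pair. As the bound for \<open>Z N\<close> is uniform
      in \<open>N\<close>, Fatou's lemma gives the same bound for \<open>X\<close>.\<close>
    have "emeasure ?YY X = (\<integral>\<^sup>+yz. indicator X yz \<partial>?YY)" by simp
    also have "\<dots> \<le> (\<integral>\<^sup>+yz. liminf (\<lambda>N. indicator (Z N) yz) \<partial>?YY)"
    proof (rule nn_integral_mono_AE)
      show "AE yz in ?YY. indicator X yz \<le> liminf (\<lambda>N. indicator (Z N) yz :: ennreal)"
        using AE_ratio_resample[OF F] AE_space
      proof eventually_elim
        case (elim yz)
        have sp: "fst yz \<in> space Y" "resample F yz \<in> space Y"
          by (rule measurable_space[OF measurable_fst elim(2)], rule measurable_space[OF resample_meas elim(2)])
        have "1 \<le> liminf (\<lambda>N. indicator (Z N) yz :: ennreal)" if "yz \<in> X"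
        proof (rule Liminf_bounded)
          have "\<forall>\<^sub>F N in sequentially. \<bar>ratio (indicator C) N (fst yz) - ratio (indicator C) N (resample F yz)\<bar> < 1/2"
            using tendstoD[OF elim(1), of "1/2"] by (simp add: dist_real_def)
          then show "\<forall>\<^sub>F N in sequentially. 1 \<le> (indicator (Z N) yz :: ennreal)"
          proof eventually_elim
            case (elim N)
            have "\<bar>indicator E (fst yz) - indicator E (resample F yz) :: real\<bar> = 1"
              using that by (auto simp: X_def indicator_def)
            then have "1/4 < \<bar>ratio (indicator C) N (fst yz) - indicator E (fst yz)\<bar> \<or>
              1/4 < \<bar>ratio (indicator C) N (resample F yz) - indicator E (resample F yz)\<bar>"
              using elim by linarith
            then have "yz \<in> Z N" using sp that by (auto simp: Z_def B_def X_def)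
            then show ?case by simp
          qed
        qed
        then show ?case by (cases "yz \<in> X") simp_all
      qed
    qed
    also have "\<dots> \<le> liminf (\<lambda>N. \<integral>\<^sup>+yz. indicator (Z N) yz \<partial>?YY)"
      by (rule nn_integral_liminf) measurable
    also have "\<dots> \<le> ennreal (8 * \<epsilon>)"
    proof (rule Liminf_le)
      show "\<forall>\<^sub>F N in sequentially. (\<integral>\<^sup>+yz. indicator (Z N) yz \<partial>?YY) \<le> ennreal (8 * \<epsilon>)"
        using eventually_gt_at_top[of 0] by eventually_elim (simp add: Z)
    qed simp
    finally have X: "emeasure ?YY X \<le> ennreal (8 * \<epsilon>)" .
    define G where "G = sym_diff E C"
    have [measurable]: "G \<in> sets Y" unfolding G_def by measurable
    have G: "emeasure Y G \<le> ennreal \<epsilon>"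
      using err by (simp add: G_def Y.emeasure_eq_measure ennreal_leI)
    \<comment> \<open>The resampled point and \<open>z\<close> agree on \<open>F\<close>, so
      \<open>C\<close> cannot separate them. If \<open>z\<close> is outside \<open>E\<close>, then
      either the resampled point is outside \<open>E\<close> as well and the pair is in
      \<open>X\<close>, or \<open>C\<close> misjudges one of the two. Together 8 + 1 + 1 gives the
      factor 10.\<close>
    have sub: "E \<times> (space Y - E) \<subseteq> X \<union> ((resample F -` G \<inter> space ?YY) \<union> (snd -` G \<inter> space ?YY))"
    proof (rule subsetI)
      fix yz assume "yz \<in> E \<times> (space Y - E)"
      then obtain y z where yz: "yz = (y, z)" "y \<in> E" "z \<in> space Y" "z \<notin> E" by auto
      have y: "y \<in> space Y" using sets.sets_into_space[OF E] yz(2) by auto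
      have sp: "yz \<in> space ?YY" using y yz by (simp add: space_pair_measure)
      have r: "resample F yz \<in> space Y" using measurable_space[OF resample_meas sp] .
      have "\<forall>p\<in>F. resample F yz p = z p" by (simp add: yz(1) resample_def)
      then have "resample F yz \<in> C \<longleftrightarrow> z \<in> C"
        using F(2)[unfolded depends_on_def, rule_format, OF r yz(3)] by blast
      then show "yz \<in> X \<union> ((resample F -` G \<inter> space ?YY) \<union> (snd -` G \<inter> space ?YY))"
        using yz sp by (auto simp: X_def G_def)
    qed
    have "ennreal (measure Y E * measure Y (space Y - E)) = emeasure ?YY (E \<times> (space Y - E))"
      by (subst Y.emeasure_pair_measure_Times) (auto simp: Y.emeasure_eq_measure ennreal_mult)
    also have "\<dots> \<le> emeasure ?YY (X \<union> ((resample F -` G \<inter> space ?YY) \<union> (snd -` G \<inter> space ?YY)))"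
      using sub by (rule emeasure_mono) measurable
    also have "\<dots> \<le> emeasure ?YY X + (emeasure ?YY (resample F -` G \<inter> space ?YY) + emeasure ?YY (snd -` G \<inter> space ?YY))"
      by (intro order_trans[OF emeasure_subadditive] add_left_mono emeasure_subadditive) measurable
    also have "emeasure ?YY (resample F -` G \<inter> space ?YY) = emeasure (distr ?YY Y (resample F)) G"
      by (rule emeasure_distr[symmetric]) measurable
    also have "\<dots> = emeasure Y G" by (simp add: distr_resample)
    also have "emeasure ?YY (snd -` G \<inter> space ?YY) = emeasure (distr ?YY Y snd) G"
      by (rule emeasure_distr[symmetric]) measurable
    also have "\<dots> = emeasure Y G" by (simp add: distr_snd)
    also have "emeasure ?YY X + (emeasure Y G + emeasure Y G) \<le> ennreal (8 * \<epsilon>) + (ennreal \<epsilon> + ennreal \<epsilon>)"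
      by (intro add_mono X G)
    also have "\<dots> = ennreal (10 * \<epsilon>)" using eps by (simp flip: ennreal_plus)
    finally show ?thesis using eps by (subst (asm) ennreal_le_iff) auto
  qed
  have "measure Y E * measure Y (space Y - E) \<le> 0"
  proof (rule field_le_epsilon)
    show "measure Y E * measure Y (space Y - E) \<le> 0 + \<epsilon>" if "0 < \<epsilon>" for \<epsilon>
      using bound[of "\<epsilon> / 10"] that by simp
  qed
  moreover have "0 \<le> measure Y E * measure Y (space Y - E)" by simp
  ultimately have "measure Y E * measure Y (space Y - E) = 0" by (rule antisym)
  then show ?thesis by (simp add: Y.emeasure_eq_measure)
qed

end

section \<open>Passage to the nested product\<close>

text \<open>The coordinates are independent, hence so are functions of disjoint blocks of them, and
  the joint law of independent variables is the product of their laws.\<close>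

lemma distr_PiM_blocks:
  fixes P :: "'i \<times> 'j \<Rightarrow> 'a measure"
  assumes P: "\<And>p. prob_space (P p)" and J: "J \<noteq> {}"
  shows "distr (Pi\<^sub>M UNIV P) (\<Pi>\<^sub>M j\<in>J. \<Pi>\<^sub>M i\<in>UNIV. P (j, i)) (\<lambda>y. \<lambda>j\<in>J. \<lambda>i. y (j, i))
    = (\<Pi>\<^sub>M j\<in>J. \<Pi>\<^sub>M i\<in>UNIV. P (j, i))"
proof -
  interpret Y: prob_space "Pi\<^sub>M UNIV P" by (rule prob_space_PiM) (rule P)
  have "Y.indep_vars P (\<lambda>p y. y p) UNIV"
  proof (subst Y.indep_vars_iff_distr_eq_PiM)
    have "distr (Pi\<^sub>M UNIV P) (Pi\<^sub>M UNIV P) (\<lambda>x. \<lambda>p\<in>UNIV. x p) = Pi\<^sub>M UNIV P"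
      by (simp add: restrict_UNIV distr_id)
    also have "\<dots> = Pi\<^sub>M UNIV (\<lambda>p. distr (Pi\<^sub>M UNIV P) (P p) (\<lambda>y. y p))"
      using P by (intro PiM_cong) (simp_all add: distr_PiM_component)
    finally show "distr (Pi\<^sub>M UNIV P) (Pi\<^sub>M UNIV P) (\<lambda>x. \<lambda>p\<in>UNIV. x p)
      = Pi\<^sub>M UNIV (\<lambda>p. distr (Pi\<^sub>M UNIV P) (P p) (\<lambda>y. y p))" .
  qed simp_all
  then have "Y.indep_vars (\<lambda>j. Pi\<^sub>M ({j} \<times> UNIV) P) (\<lambda>j y. restrict (\<lambda>p. y p) ({j} \<times> UNIV)) J"
    by (rule Y.indep_vars_restrict) (auto simp: disjoint_family_on_def)
  then have "Y.indep_vars (\<lambda>j. \<Pi>\<^sub>M i\<in>UNIV. P (j, i))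
      (\<lambda>j y. (\<lambda>z i. z (j, i)) (restrict (\<lambda>p. y p) ({j} \<times> UNIV))) J"
  proof (rule Y.indep_vars_compose2)
    show "(\<lambda>z i. z (j, i)) \<in> measurable (Pi\<^sub>M ({j} \<times> UNIV) P) (\<Pi>\<^sub>M i\<in>UNIV. P (j, i))" for j
      by (rule measurable_PiM_single') (auto simp: space_PiM PiE_def Pi_def)
  qed
  then have ind: "Y.indep_vars (\<lambda>j. \<Pi>\<^sub>M i\<in>UNIV. P (j, i)) (\<lambda>j y i. y (j, i)) J"
    by simp
  have meas: "(\<lambda>y i. y (j, i)) \<in> measurable (Pi\<^sub>M UNIV P) (\<Pi>\<^sub>M i\<in>UNIV. P (j, i))" for j
    by (rule measurable_PiM_single') (auto simp: space_PiM PiE_def Pi_def)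
  have marg: "distr (Pi\<^sub>M UNIV P) (\<Pi>\<^sub>M i\<in>UNIV. P (j, i)) (\<lambda>y i. y (j, i)) = (\<Pi>\<^sub>M i\<in>UNIV. P (j, i))" for j
    using distr_PiM_reindex[of UNIV P "Pair j" UNIV] P by (simp add: restrict_UNIV inj_on_def)
  have "distr (Pi\<^sub>M UNIV P) (\<Pi>\<^sub>M j\<in>J. \<Pi>\<^sub>M i\<in>UNIV. P (j, i)) (\<lambda>y. \<lambda>j\<in>J. \<lambda>i. y (j, i))
    = (\<Pi>\<^sub>M j\<in>J. distr (Pi\<^sub>M UNIV P) (\<Pi>\<^sub>M i\<in>UNIV. P (j, i)) (\<lambda>y i. y (j, i)))"
    using Y.indep_vars_iff_distr_eq_PiM'[OF J meas] ind by simp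
  then show ?thesis unfolding marg .
qed

text \<open>Null sets and invariance can be tested on preimages under \<open>\<pi>\<close>.
  Invertibility of \<open>R\<close> is asked for separately, since a factor map need not be
  injective.\<close>

lemma ergodic_factor:
  assumes S: "S \<in> measurable Y Y" and \<pi> [measurable]: "\<pi> \<in> measurable Y N" and distr: "distr Y N \<pi> = N"
    and equivariant: "\<And>y. y \<in> space Y \<Longrightarrow> \<pi> (S y) = R (\<pi> y)"
    and nonsingular: "\<And>E. E \<in> sets Y \<Longrightarrow> emeasure Y (S -` E \<inter> space Y) = 0 \<longleftrightarrow> emeasure Y E = 0"
    and trivial: "\<And>E. E \<in> sets Y \<Longrightarrow> AE y in Y. S y \<in> E \<longleftrightarrow> y \<in> E \<Longrightarrow>
      emeasure Y E = 0 \<or> emeasure Y (space Y - E) = 0"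
    and R: "bij_betw R (space N) (space N)" and R_meas [measurable]: "R \<in> measurable N N"
    and R_inv: "the_inv_into (space N) R \<in> measurable N N"
  shows "ergodic N R"
proof -
  have em: "emeasure N E = emeasure Y (\<pi> -` E \<inter> space Y)" if "E \<in> sets N" for E
    using emeasure_distr[OF \<pi> that] distr by simp
  have \<pi>_space: "y \<in> space Y \<Longrightarrow> \<pi> y \<in> space N" for y using measurable_space[OF \<pi>] .
  have S_space: "y \<in> space Y \<Longrightarrow> S y \<in> space Y" for y using measurable_space[OF S] .
  have pull: "\<pi> -` (R -` E \<inter> space N) \<inter> space Y = S -` (\<pi> -` E \<inter> space Y) \<inter> space Y" for E
    using \<pi>_space S_space equivariant by auto
  have [measurable]: "R -` E \<inter> space N \<in> sets N" if "E \<in> sets N" for E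
    using measurable_sets[OF R_meas that] .
  have "invertible_nonsingular N R"
    unfolding invertible_nonsingular_def
  proof (intro conjI ballI R R_meas R_inv)
    fix E assume E [measurable]: "E \<in> sets N"
    show "emeasure N (R -` E \<inter> space N) = 0 \<longleftrightarrow> emeasure N E = 0"
    proof -
      have "R -` E \<inter> space N \<in> sets N" by measurable
      from em[OF this] em[OF E] show ?thesis unfolding pull by (simp only: nonsingular measurable_sets[OF \<pi> E])
    qed
  qed
  moreover have "emeasure N E = 0 \<or> emeasure N (space N - E) = 0"
    if E [measurable]: "E \<in> sets N"
      and inv: "emeasure N (E - (R -` E \<inter> space N) \<union> ((R -` E \<inter> space N) - E)) = 0" for E
  proof -
    let ?D = "E - (R -` E \<inter> space N) \<union> ((R -` E \<inter> space N) - E)"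
    let ?E = "\<pi> -` E \<inter> space Y"
    have "AE y in Y. S y \<in> ?E \<longleftrightarrow> y \<in> ?E"
    proof (rule AE_I)
      show "{y\<in>space Y. \<not> (S y \<in> ?E \<longleftrightarrow> y \<in> ?E)} \<subseteq> \<pi> -` ?D \<inter> space Y"
        using \<pi>_space S_space equivariant by auto
      show "emeasure Y (\<pi> -` ?D \<inter> space Y) = 0" using inv em[of ?D] by simp
    qed simp
    then have "emeasure Y ?E = 0 \<or> emeasure Y (space Y - ?E) = 0"
      by (intro trivial) simp_all
    moreover have "\<pi> -` (space N - E) \<inter> space Y = space Y - ?E" using \<pi>_space by auto
    ultimately show ?thesis by (simp add: em)
  qed
  ultimately show ?thesis unfolding ergodic_def by blast
qed

section \<open>Integer iterates of the shift and their products\<close>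

lemma the_inv_into_bernoulli_shift:
  assumes "\<And>i. x i \<in> U"
  shows "the_inv_into {x. \<forall>i. x i \<in> U} bernoulli_shift x = (\<lambda>i. x (i - 1))"
proof (rule the_inv_into_f_eq)
  show "inj_on bernoulli_shift {x. \<forall>i. x i \<in> U}"
    by (rule inj_on_inverseI[of _ "\<lambda>x i. x (i - 1)"]) (simp add: bernoulli_shift_def)
qed (use assms in \<open>auto simp: bernoulli_shift_def\<close>)

text \<open>Restricted to points of the cube because negative iterates use
  \<open>the_inv_into\<close>, which is characterized only on the image; every translate of such a
  point is again in the cube.\<close>

lemma int_iterate_bernoulli_shift:
  assumes "\<And>i. x i \<in> U"
  shows "int_iterate {x. \<forall>i. x i \<in> U} bernoulli_shift n x = (\<lambda>i. x (i + n))"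
proof -
  have fwd: "(bernoulli_shift ^^ m) x = (\<lambda>i. x (i + int m))" for m
    by (induction m) (simp_all add: bernoulli_shift_def algebra_simps)
  have bwd: "(the_inv_into {x. \<forall>i. x i \<in> U} bernoulli_shift ^^ m) x = (\<lambda>i. x (i - int m))" for m
  proof (induction m)
    case (Suc m)
    then show ?case using assms by (simp add: the_inv_into_bernoulli_shift algebra_simps)
  qed simp
  show ?thesis by (simp add: int_iterate_def fwd bwd)
qed

lemma product_map_shift:
  assumes "x \<in> {..<k} \<rightarrow>\<^sub>E {x. \<forall>i. x i \<in> U}"
  shows "product_map k (\<lambda>j. int_iterate {x. \<forall>i. x i \<in> U} bernoulli_shift (n j)) x
    = (\<lambda>j\<in>{..<k}. \<lambda>i. x j (i + n j))"
  unfolding product_map_def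
proof (rule restrict_ext)
  fix j assume "j \<in> {..<k}"
  then have "x j \<in> {x. \<forall>i. x i \<in> U}" using assms by (rule PiE_mem[rotated])
  then show "int_iterate {x. \<forall>i. x i \<in> U} bernoulli_shift (n j) (x j) = (\<lambda>i. x j (i + n j))"
    by (intro int_iterate_bernoulli_shift) simp
qed

lemma product_map_shift_bij:
  fixes U :: "'a set" and n :: "nat \<Rightarrow> int"
  defines "\<Omega> \<equiv> {x :: int \<Rightarrow> 'a. \<forall>i. x i \<in> U}"
  shows "bij_betw (product_map k (\<lambda>j. int_iterate \<Omega> bernoulli_shift (n j))) ({..<k} \<rightarrow>\<^sub>E \<Omega>) ({..<k} \<rightarrow>\<^sub>E \<Omega>)"
    and "x \<in> {..<k} \<rightarrow>\<^sub>E \<Omega> \<Longrightarrow>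
      the_inv_into ({..<k} \<rightarrow>\<^sub>E \<Omega>) (product_map k (\<lambda>j. int_iterate \<Omega> bernoulli_shift (n j))) x
        = (\<lambda>j\<in>{..<k}. \<lambda>i. x j (i - n j))"
proof -
  let ?R = "product_map k (\<lambda>j. int_iterate \<Omega> bernoulli_shift (n j))"
  let ?R' = "\<lambda>x. \<lambda>j\<in>{..<k}. \<lambda>i. x j (i - n j)"
  have R: "?R x = (\<lambda>j\<in>{..<k}. \<lambda>i. x j (i + n j))" if "x \<in> {..<k} \<rightarrow>\<^sub>E \<Omega>" for x
    unfolding \<Omega>_def by (rule product_map_shift) (use that in \<open>simp add: \<Omega>_def\<close>)
  have R_in: "?R x \<in> {..<k} \<rightarrow>\<^sub>E \<Omega>" if "x \<in> {..<k} \<rightarrow>\<^sub>E \<Omega>" for x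
    unfolding R[OF that] using that by (auto simp: \<Omega>_def PiE_iff)
  have R'_in: "?R' x \<in> {..<k} \<rightarrow>\<^sub>E \<Omega>" if "x \<in> {..<k} \<rightarrow>\<^sub>E \<Omega>" for x
    using that by (auto simp: \<Omega>_def PiE_iff)
  have 1: "?R' (?R x) = x" if "x \<in> {..<k} \<rightarrow>\<^sub>E \<Omega>" for x
    unfolding R[OF that] using that by (auto simp: fun_eq_iff PiE_iff extensional_def)
  have 2: "?R (?R' x) = x" if "x \<in> {..<k} \<rightarrow>\<^sub>E \<Omega>" for x
    unfolding R[OF R'_in[OF that]] using that by (auto simp: fun_eq_iff PiE_iff extensional_def)
  show bij: "bij_betw ?R ({..<k} \<rightarrow>\<^sub>E \<Omega>) ({..<k} \<rightarrow>\<^sub>E \<Omega>)"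
    by (rule bij_betw_byWitness[of _ ?R']) (intro ballI image_subsetI 1 2 R_in R'_in; assumption)+
  show "the_inv_into ({..<k} \<rightarrow>\<^sub>E \<Omega>) ?R x = ?R' x" if "x \<in> {..<k} \<rightarrow>\<^sub>E \<Omega>"
    by (rule the_inv_into_f_eq[OF bij_betw_imp_inj_on[OF bij] 2[OF that] R'_in[OF that]])
qed

section \<open>The densities of the example\<close>

text \<open>This is a_(l+2): the numbering starts at 0 where the sequence of intervals
  starts.\<close>

definition mass :: "nat \<Rightarrow> real" where
  "mass l = 1 / ((real l + 6) * ln (real l + 6))"

lemma mass_nonneg: "0 \<le> mass l"
  by (simp add: mass_def)

lemma mass_tendsto_0: "mass \<longlonglongrightarrow> 0"
  unfolding mass_def by real_asymp

text \<open>The true order is log log, but an arbitrarily small multiple of log is enough: the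
  factor \<open>1 / ln (real l + 6)\<close> eventually drops below \<open>\<delta>\<close>, and the
  rest is compared with the increments of ln, which telescope. \<open>B\<close> absorbs the initial
  terms.\<close>

lemma sum_mass_le_ln:
  assumes "0 < \<delta>"
  obtains B where "\<And>m. (\<Sum>l<m. mass l) \<le> \<delta> * ln (real m + 1) + B"
proof -
  have "\<forall>\<^sub>F l in sequentially. 1 / ln (real l + 6) < \<delta>"
    by (rule order_tendstoD(2)[OF _ assms]) real_asymp
  then obtain l0 where l0: "\<And>l. l0 \<le> l \<Longrightarrow> 1 / ln (real l + 6) < \<delta>"
    by (auto simp: eventually_sequentially)
  have step: "mass l \<le> \<delta> * (ln (real l + 2) - ln (real l + 1))" if "l0 \<le> l" for l
  proof -
    have "mass l = 1 / ln (real l + 6) * (1 / (real l + 6))" by (simp add: mass_def)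
    also have "\<dots> \<le> \<delta> * (1 / (real l + 2))"
      using l0[OF that] assms by (intro mult_mono) (auto simp: frac_le)
    also have "1 / (real l + 2) \<le> ln (real l + 2) - ln (real l + 1)"
      using ln_diff_le[of "real l + 1" "real l + 2"] by simp
    finally show ?thesis using assms by simp
  qed
  have "(\<Sum>l<m. mass l) \<le> \<delta> * ln (real m + 1) + (\<Sum>l<l0. mass l)" for m
  proof (induction m)
    case 0
    show ?case by (simp add: sum_nonneg mass_nonneg)
  next
    case (Suc m)
    show ?case
    proof (cases "l0 \<le> m")
      case True
      then show ?thesis using Suc step[OF True] by (simp add: algebra_simps)
    next
      case False
      then have "(\<Sum>l<Suc m. mass l) \<le> (\<Sum>l<l0. mass l)"
        by (intro sum_mono2) (auto simp: mass_nonneg)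
      moreover have "0 \<le> \<delta> * ln (real (Suc m) + 1)" using assms by simp
      ultimately show ?thesis by linarith
    qed
  qed
  then show ?thesis by (rule that)
qed

locale nested_bumps =
  fixes lam :: real and A B :: "int \<Rightarrow> real set" and f :: "int \<Rightarrow> real \<Rightarrow> real"
  assumes lam: "0 < lam" "lam < 1"
    and A_borel: "\<And>n. 2 \<le> n \<Longrightarrow> A n \<in> sets borel" and A_sub: "\<And>n. 2 \<le> n \<Longrightarrow> A n \<subseteq> {0..1}"
    and B_borel: "\<And>n. 2 \<le> n \<Longrightarrow> B n \<in> sets borel" and B_sub: "\<And>n. 2 \<le> n \<Longrightarrow> B n \<subseteq> {0..1}"
    and disj: "\<And>n. 2 \<le> n \<Longrightarrow> A n \<inter> B n = {}"
    and A_Suc: "\<And>n. 2 \<le> n \<Longrightarrow> A (n + 1) \<subseteq> A n"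
    and B_Suc: "\<And>n. 2 \<le> n \<Longrightarrow> B (n + 1) \<subseteq> B n"
    and A_mass: "\<And>l. measure lborel (A (int l + 2)) = mass l"
    and B_mass: "\<And>l. measure lborel (B (int l + 2)) = lam * mass l"
    and f_le_1: "\<And>n u. n \<le> 1 \<Longrightarrow> u \<in> {0..1} \<Longrightarrow> f n u = 1"
    and f_A: "\<And>n u. 2 \<le> n \<Longrightarrow> u \<in> A n \<Longrightarrow> f n u = lam"
    and f_B: "\<And>n u. 2 \<le> n \<Longrightarrow> u \<in> B n \<Longrightarrow> f n u = inverse lam"
    and f_else: "\<And>n u. 2 \<le> n \<Longrightarrow> u \<in> {0..1} - (A n \<union> B n) \<Longrightarrow> f n u = 1"
begin

section \<open>Normalization and bounds of the densities\<close>

definition L :: "real measure" where "L = restrict_space lborel {0..1}"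

lemma space_L [simp]: "space L = {0..1}"
  by (simp add: L_def space_restrict_space)

lemma emeasure_L: "X \<in> sets borel \<Longrightarrow> X \<subseteq> {0..1} \<Longrightarrow> emeasure L X = emeasure lborel X"
  by (simp add: L_def emeasure_restrict_space)

lemma measure_L: "X \<in> sets borel \<Longrightarrow> X \<subseteq> {0..1} \<Longrightarrow> measure L X = measure lborel X"
  by (simp add: measure_def emeasure_L)

lemma sets_L: "X \<in> sets borel \<Longrightarrow> X \<subseteq> {0..1} \<Longrightarrow> X \<in> sets L"
  by (simp add: L_def sets_restrict_space_iff)

lemma prob_space_L: "prob_space L"
  by (rule prob_spaceI) (simp add: emeasure_L)

sublocale L: prob_space L by (rule prob_space_L)

lemma A_L: "2 \<le> n \<Longrightarrow> A n \<in> sets L" and B_L: "2 \<le> n \<Longrightarrow> B n \<in> sets L"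
  by (simp_all add: sets_L A_borel A_sub B_borel B_sub)

lemma measure_A: "measure L (A (int l + 2)) = mass l" and measure_B: "measure L (B (int l + 2)) = lam * mass l"
  by (simp_all add: measure_L A_borel A_sub B_borel B_sub A_mass B_mass)

lemma f_eq:
  assumes "u \<in> {0..1}"
  shows "f n u = (if 2 \<le> n then if u \<in> A n then lam else if u \<in> B n then inverse lam else 1 else 1)"
  using assms f_le_1[of n u] f_A[of n u] f_B[of n u] f_else[of n u] by auto

lemma f_meas: "f n \<in> borel_measurable L"
proof -
  have "(\<lambda>u. if 2 \<le> n then if u \<in> A n then lam else if u \<in> B n then inverse lam else 1 else 1) \<in> borel_measurable L"
    using A_L[of n] B_L[of n] by (cases "2 \<le> n") simp_all
  then show ?thesis by (rule measurable_cong[THEN iffD2, rotated]) (simp add: f_eq)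
qed

lemma f_bounds: "u \<in> {0..1} \<Longrightarrow> lam \<le> f n u" "u \<in> {0..1} \<Longrightarrow> f n u \<le> inverse lam"
proof -
  have "1 \<le> inverse lam" using lam by (simp add: one_le_inverse)
  then show "u \<in> {0..1} \<Longrightarrow> lam \<le> f n u" "u \<in> {0..1} \<Longrightarrow> f n u \<le> inverse lam"
    using lam by (auto simp: f_eq)
qed

text \<open>The lengths are matched so that the loss \<open>(1 - lam) * mass l\<close> on
  \<open>A n\<close> equals the gain \<open>(inverse lam - 1) * (lam * mass l)\<close> on
  \<open>B n\<close>. The loss is added to both sides to avoid subtraction in
  \<open>ennreal\<close>.\<close>

lemma f_int: "(\<integral>\<^sup>+u. ennreal (f n u) \<partial>L) = 1"
proof (cases "2 \<le> n")
  case True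
  define l where "l = nat (n - 2)"
  have n: "n = int l + 2" using True by (simp add: l_def)
  have mA: "measure L (A n) = mass l" and mB: "measure L (B n) = lam * mass l"
    unfolding n by (rule measure_A measure_B)+
  have [measurable]: "A n \<in> sets L" "B n \<in> sets L" "f n \<in> borel_measurable L"
    using A_L B_L f_meas True by auto
  have il: "1 \<le> inverse lam" using lam by (simp add: one_le_inverse)
  have "(\<integral>\<^sup>+u. ennreal (f n u) \<partial>L) + ennreal ((1 - lam) * mass l)
    = (\<integral>\<^sup>+u. ennreal (f n u) + ennreal (1 - lam) * indicator (A n) u \<partial>L)"
    using lam by (subst nn_integral_add)
      (simp_all add: nn_integral_cmult_indicator L.emeasure_eq_measure mA ennreal_mult mass_nonneg)
  also have "\<dots> = (\<integral>\<^sup>+u. 1 + ennreal (inverse lam - 1) * indicator (B n) u \<partial>L)"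
  proof (rule nn_integral_cong)
    fix u assume "u \<in> space L"
    then have "f n u = (if u \<in> A n then lam else if u \<in> B n then inverse lam else 1)"
      using True by (simp add: f_eq)
    moreover have "ennreal lam + ennreal (1 - lam) = 1" "1 + ennreal (inverse lam - 1) = ennreal (inverse lam)"
      using lam il by (simp_all flip: ennreal_plus ennreal_1)
    ultimately show "ennreal (f n u) + ennreal (1 - lam) * indicator (A n) u = 1 + ennreal (inverse lam - 1) * indicator (B n) u"
      using disj[OF True] by (auto simp: indicator_def)
  qed
  also have "\<dots> = 1 + ennreal ((inverse lam - 1) * (lam * mass l))"
    using il lam by (subst nn_integral_add)
      (simp_all add: nn_integral_cmult_indicator L.emeasure_eq_measure mB ennreal_mult mass_nonneg L.prob_space[simplified])
  also have "(inverse lam - 1) * (lam * mass l) = (1 - lam) * mass l"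
    using lam by (simp add: field_simps)
  finally have "ennreal ((1 - lam) * mass l) + (\<integral>\<^sup>+u. ennreal (f n u) \<partial>L) = ennreal ((1 - lam) * mass l) + 1"
    by (simp only: add.commute)
  then show ?thesis by (subst (asm) ennreal_add_left_cancel) simp
next
  case False
  then have "(\<integral>\<^sup>+u. ennreal (f n u) \<partial>L) = (\<integral>\<^sup>+u. 1 \<partial>L)"
    by (intro nn_integral_cong) (simp add: f_eq)
  then show ?thesis using L.emeasure_space_1 by simp
qed

lemma A_antimono: "A (int (l + q) + 2) \<subseteq> A (int l + 2)" and B_antimono: "B (int (l + q) + 2) \<subseteq> B (int l + 2)"
proof (induction q)
  case (Suc q)
  have "int (l + Suc q) + 2 = (int (l + q) + 2) + 1" by simp
  then show "A (int (l + Suc q) + 2) \<subseteq> A (int l + 2)" "B (int (l + Suc q) + 2) \<subseteq> B (int l + 2)"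
    using Suc A_Suc[of "int (l + q) + 2"] B_Suc[of "int (l + q) + 2"] by auto
qed auto

section \<open>Mass of the set where a shifted density differs\<close>

definition change :: "int \<Rightarrow> int \<Rightarrow> real" where
  "change m i = measure L {u\<in>space L. f (i - m) u \<noteq> f i u}"

text \<open>For \<open>l < m\<close> the shifted index is below 2, where the density is 1, so the
  change is confined to the two intervals. Otherwise both densities have intervals, one pair inside
  the other, and the change is confined to the set differences, whose masses subtract.\<close>

lemma change_bound:
  "change (int m) (int l + 2) \<le> (1 + lam) * (if l < m then mass l else mass (l - m) - mass l)"
proof (cases "l < m")
  case True
  have "{u\<in>space L. f (int l + 2 - int m) u \<noteq> f (int l + 2) u} \<subseteq> A (int l + 2) \<union> B (int l + 2)"
    using True by (auto simp: f_eq split: if_splits)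
  then have "change (int m) (int l + 2) \<le> measure L (A (int l + 2) \<union> B (int l + 2))"
    unfolding change_def by (intro L.finite_measure_mono) (auto simp: A_L B_L)
  also have "\<dots> \<le> measure L (A (int l + 2)) + measure L (B (int l + 2))"
    by (intro measure_Un_le) (auto simp: A_L B_L)
  finally show ?thesis using True by (simp add: measure_A measure_B algebra_simps)
next
  case False
  define q where "q = l - m"
  have l: "l = q + m" using False by (simp add: q_def)
  have i: "int l + 2 - int m = int q + 2" by (simp add: l)
  let ?A = "A (int q + 2) - A (int l + 2)" and ?B = "B (int q + 2) - B (int l + 2)"
  have sub: "A (int l + 2) \<subseteq> A (int q + 2)" "B (int l + 2) \<subseteq> B (int q + 2)"
    unfolding l by (rule A_antimono B_antimono)+
  \<comment> \<open>Disjointness at the earlier index excludes a passage from \<open>A\<close> to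
    \<open>B\<close>: a point of the smaller \<open>B\<close> lies in the larger one as
    well.\<close>
  have "{u\<in>space L. f (int q + 2) u \<noteq> f (int l + 2) u} \<subseteq> ?A \<union> ?B"
    using sub disj[of "int q + 2"] by (auto simp: f_eq split: if_splits)
  then have "change (int m) (int l + 2) \<le> measure L (?A \<union> ?B)"
    unfolding change_def i by (intro L.finite_measure_mono sets.Un sets.Diff A_L B_L) simp_all
  also have "\<dots> \<le> measure L ?A + measure L ?B"
    by (intro measure_Un_le sets.Diff A_L B_L) simp_all
  also have "measure L ?A = mass q - mass l"
    by (subst L.finite_measure_Diff) (use sub in \<open>auto simp: A_L measure_A\<close>)
  also have "measure L ?B = lam * mass q - lam * mass l"
    by (subst L.finite_measure_Diff) (use sub in \<open>auto simp: B_L measure_B\<close>)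
  finally show ?thesis using False by (simp add: q_def[symmetric] algebra_simps)
qed

text \<open>The first \<open>m\<close> indices contribute their masses. The differences over the
  remaining indices telescope to at most the same sum again, whence the factor 2 and a bound
  independent of \<open>F\<close>.\<close>

lemma sum_change_bound_nat:
  assumes F: "finite F"
  shows "(\<Sum>i\<in>F. change (int m) i) \<le> 2 * (1 + lam) * (\<Sum>l<m. mass l)"
proof -
  define g where "g l = (if l < m then mass l else mass (l - m) - mass l)" for l
  \<comment> \<open>Any upper bound for the elements of \<open>F\<close> would serve; the sum of
    their positive parts is one.\<close>
  define N where "N = (\<Sum>i\<in>F. nat i)"
  have change_nonneg: "0 \<le> change (int m) i" for i by (simp add: change_def)
  have zero: "change (int m) i = 0" if "i < 2" for i
    using that by (simp add: change_def f_eq cong: conj_cong)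
  have "i \<in> (\<lambda>l. int l + 2) ` {..<m + N}" if "i \<in> F" "2 \<le> i" for i
  proof
    have "nat i \<le> N" unfolding N_def using F that(1) by (rule_tac member_le_sum) auto
    then show "nat (i - 2) \<in> {..<m + N}" using that(2) by auto
  qed (use that in simp)
  then have "(\<Sum>i\<in>F. change (int m) i) \<le> (\<Sum>i\<in>(\<lambda>l. int l + 2) ` {..<m + N}. change (int m) i)"
    using F change_nonneg zero
    by (subst sum.mono_neutral_right[of F "F \<inter> {2..}"]) (auto intro!: sum_mono2 simp: not_le[symmetric])
  also have "\<dots> = (\<Sum>l<m + N. change (int m) (int l + 2))"
    by (subst sum.reindex) (auto simp: inj_on_def)
  also have "\<dots> \<le> (\<Sum>l<m + N. (1 + lam) * g l)"
    unfolding g_def by (intro sum_mono change_bound)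
  also have "\<dots> = (1 + lam) * (\<Sum>l<m + N. g l)"
    by (simp add: sum_distrib_left)
  also have "(\<Sum>l<m + N. g l) = 2 * (\<Sum>l<m. mass l) + (\<Sum>l<N. mass l) - (\<Sum>l<m + N. mass l)"
  proof (induction N)
    case 0
    have "(\<Sum>l<m. g l) = (\<Sum>l<m. mass l)" by (rule sum.cong) (auto simp: g_def)
    then show ?case by simp
  qed (simp add: g_def)
  also have "\<dots> \<le> 2 * (\<Sum>l<m. mass l)"
    using sum_mono2[of "{..<m + N}" "{..<N}" mass] mass_nonneg by simp
  finally have "(\<Sum>i\<in>F. change (int m) i) \<le> (1 + lam) * (2 * (\<Sum>l<m. mass l))"
    using lam by simp
  then show ?thesis by (simp only: mult_ac)
qed

text \<open>Comparing index \<open>i\<close> with \<open>i + q\<close> is the same as comparing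
  \<open>i + q\<close> with its shift by \<open>q\<close>, so a negative shift is a positive one
  after translating \<open>F\<close>.\<close>

lemma sum_change_bound:
  assumes F: "finite F"
  shows "(\<Sum>i\<in>F. change m i) \<le> 2 * (1 + lam) * (\<Sum>l<nat \<bar>m\<bar>. mass l)"
proof (cases "0 \<le> m")
  case True
  then show ?thesis using sum_change_bound_nat[OF F, of "nat m"] by simp
next
  case False
  define q where "q = nat (- m)"
  have q: "m = - int q" using False by (simp add: q_def)
  have "change m i = change (int q) (i + int q)" for i
    unfolding change_def q by (simp add: eq_commute)
  then have "(\<Sum>i\<in>F. change m i) = (\<Sum>i\<in>(\<lambda>i. i + int q) ` F. change (int q) i)"
    by (subst sum.reindex) (auto simp: inj_on_def)
  also have "\<dots> \<le> 2 * (1 + lam) * (\<Sum>l<q. mass l)"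
    by (rule sum_change_bound_nat) (use F in simp)
  finally show ?thesis by (simp add: q)
qed

text \<open>Masses tending to 0 make the intersection of the intervals null, and by nesting a point
  that has left one of them never returns.\<close>

lemma AE_eventually_f_eq_1: "AE u in L. \<forall>\<^sub>F l in sequentially. f (int l) u = 1"
proof -
  have out: "AE u in L. \<exists>l. u \<notin> X (int l + 2)"
    if X: "\<And>l. X (int l + 2) \<in> sets L" and le: "\<And>l. measure L (X (int l + 2)) \<le> mass l" for X :: "int \<Rightarrow> real set"
  proof -
    let ?N = "\<Inter>l. X (int l + 2)"
    have [measurable]: "?N \<in> sets L" using X by auto
    have "measure L ?N \<le> mass l" for l
      by (rule order_trans[OF L.finite_measure_mono le]) (use X in auto)
    then have "measure L ?N \<le> 0"
      by (intro tendsto_lowerbound[OF mass_tendsto_0]) auto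
    then have "measure L ?N = 0" by (intro antisym measure_nonneg)
    then have "AE u in L. u \<notin> ?N" by (rule L.prob_eq_0[THEN iffD1, rotated]) simp
    then show ?thesis by eventually_elim simp
  qed
  have "AE u in L. \<exists>l. u \<notin> A (int l + 2)" by (rule out) (simp_all add: A_L measure_A)
  moreover have "AE u in L. \<exists>l. u \<notin> B (int l + 2)"
    by (rule out) (use lam in \<open>simp_all add: B_L measure_B mass_nonneg mult_left_le_one_le\<close>)
  ultimately show ?thesis using AE_space
  proof eventually_elim
    case (elim u)
    then obtain a b where ab: "u \<notin> A (int a + 2)" "u \<notin> B (int b + 2)" by blast
    have "f (int l) u = 1" if "a + b + 2 \<le> l" for l
    proof -
      have ea: "int (a + (l - 2 - a)) + 2 = int l" and eb: "int (b + (l - 2 - b)) + 2 = int l" using that by auto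
      have "u \<notin> A (int l)" "u \<notin> B (int l)"
        using A_antimono[of a "l - 2 - a", unfolded ea] B_antimono[of b "l - 2 - b", unfolded eb] ab by blast+
      then show ?thesis using elim(3) by (simp add: f_eq)
    qed
    then show ?case unfolding eventually_sequentially by blast
  qed
qed

lemma exp_sum_mass_le_sqrt:
  fixes d :: "nat \<Rightarrow> int" and c :: real
  assumes c: "0 < c"
  obtains K where "\<And>N. exp (c * (\<Sum>j<k. 2 * (1 + lam) * (\<Sum>l<nat \<bar>int N * d j\<bar>. mass l))) \<le> K * sqrt (real (Suc N))"
proof -
  \<comment> \<open>Chosen so that
    \<open>c * (2 * (1 + lam) * (real k + 1)) * \<delta> = 1/2\<close>, the exponent of the square
    root; \<open>real k + 1\<close> keeps the denominator nonzero for \<open>k = 0\<close>.\<close>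
  define \<delta> where "\<delta> = 1 / (2 * c * (2 * (1 + lam) * (real k + 1)))"
  have delta: "0 < \<delta>" using c lam by (simp add: \<delta>_def)
  obtain B where B: "\<And>m. (\<Sum>l<m. mass l) \<le> \<delta> * ln (real m + 1) + B"
    using sum_mass_le_ln[OF delta] by blast
  define C where "C = (\<Sum>j<k. 2 * (1 + lam) * (\<delta> * ln (real_of_int \<bar>d j\<bar> + 1) + B))"
  have main: "(\<Sum>j<k. 2 * (1 + lam) * (\<Sum>l<nat \<bar>int N * d j\<bar>. mass l)) \<le> ln (real (Suc N)) / (2 * c) + C" for N
  proof -
    have "(\<Sum>l<nat \<bar>int N * d j\<bar>. mass l) \<le> \<delta> * ln (real (Suc N)) + (\<delta> * ln (real_of_int \<bar>d j\<bar> + 1) + B)" for j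
    proof -
      have "(\<Sum>l<nat \<bar>int N * d j\<bar>. mass l) \<le> \<delta> * ln (real (nat \<bar>int N * d j\<bar>) + 1) + B" by (rule B)
      also have "real (nat \<bar>int N * d j\<bar>) + 1 = real N * \<bar>real_of_int (d j)\<bar> + 1"
        by (simp add: abs_mult)
      \<comment> \<open>Bounding by a product inside the logarithm separates \<open>N\<close> from
        \<open>d j\<close>, so that the step sizes only enter the constant \<open>C\<close>.\<close>
      also have "\<delta> * ln (real N * \<bar>real_of_int (d j)\<bar> + 1) \<le> \<delta> * ln (real (Suc N) * (\<bar>real_of_int (d j)\<bar> + 1))"
        using delta by (intro mult_left_mono) (auto simp: algebra_simps add_pos_nonneg)
      also have "ln (real (Suc N) * (\<bar>real_of_int (d j)\<bar> + 1)) = ln (real (Suc N)) + ln (real_of_int \<bar>d j\<bar> + 1)"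
        by (subst ln_mult) auto
      finally show ?thesis by (simp add: algebra_simps)
    qed
    then have "(\<Sum>j<k. 2 * (1 + lam) * (\<Sum>l<nat \<bar>int N * d j\<bar>. mass l))
        \<le> (\<Sum>j<k. 2 * (1 + lam) * (\<delta> * ln (real (Suc N)) + (\<delta> * ln (real_of_int \<bar>d j\<bar> + 1) + B)))"
      using lam by (intro sum_mono mult_left_mono) auto
    also have "\<dots> = real k * (2 * (1 + lam) * (\<delta> * ln (real (Suc N)))) + C"
      unfolding C_def by (simp add: distrib_left sum.distrib)
    also have "real k * (2 * (1 + lam) * (\<delta> * ln (real (Suc N)))) \<le> (real k + 1) * (2 * (1 + lam) * (\<delta> * ln (real (Suc N))))"
      using lam delta by (intro mult_right_mono mult_nonneg_nonneg) auto
    also have "\<dots> = ((real k + 1) * (2 * (1 + lam)) * \<delta>) * ln (real (Suc N))"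
      by (simp only: mult_ac)
    also have "(real k + 1) * (2 * (1 + lam)) * \<delta> = 1 / (2 * c)"
    proof -
      define X where "X = (real k + 1) * (2 * (1 + lam))"
      have "0 < X" using lam unfolding X_def by simp
      moreover have "\<delta> = 1 / (2 * c * X)" unfolding \<delta>_def X_def by (simp only: mult_ac)
      ultimately show ?thesis unfolding X_def[symmetric] by simp
    qed
    finally show ?thesis by simp
  qed
  have "exp (c * (\<Sum>j<k. 2 * (1 + lam) * (\<Sum>l<nat \<bar>int N * d j\<bar>. mass l))) \<le> exp (c * C) * sqrt (real (Suc N))" for N
  proof -
    have "exp (c * (\<Sum>j<k. 2 * (1 + lam) * (\<Sum>l<nat \<bar>int N * d j\<bar>. mass l))) \<le> exp (c * (ln (real (Suc N)) / (2 * c) + C))"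
      using main[of N] c by simp
    also have "c * (ln (real (Suc N)) / (2 * c) + C) = c * C + ln (sqrt (real (Suc N)))"
      using c by (simp add: ln_sqrt distrib_left)
    also have "exp \<dots> = exp (c * C) * sqrt (real (Suc N))"
      by (simp add: exp_add)
    finally show ?thesis .
  qed
  then show ?thesis by (rule that)
qed

text \<open>The progression runs to plus or minus infinity according to the sign of
  \<open>d\<close>, and \<open>Q\<close> is known near both ends.\<close>

lemma eventually_of_int_multiple:
  assumes d: "d \<noteq> (0::int)" and pos: "\<forall>\<^sub>F l in sequentially. Q (int l)" and neg: "\<And>i. i \<le> 1 \<Longrightarrow> Q i"
  shows "\<forall>\<^sub>F N in sequentially. Q (i + int N * d)"
proof -
  obtain l0 where l0: "\<And>l. l0 \<le> l \<Longrightarrow> Q (int l)" using pos by (auto simp: eventually_sequentially)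
  have "Q (i + int N * d)" if N: "nat \<bar>i\<bar> + l0 + 1 \<le> N" for N
  proof (cases "0 < d")
    case True
    then have "int N * 1 \<le> int N * d" by (intro mult_left_mono) auto
    then have "int l0 \<le> i + int N * d" using N by linarith
    then show ?thesis using l0[of "nat (i + int N * d)"] by simp
  next
    case False
    then have "int N * d \<le> int N * (-1)" using d by (intro mult_left_mono) auto
    then show ?thesis using N by (intro neg) linarith
  qed
  then show ?thesis unfolding eventually_sequentially by blast
qed

section \<open>The product of powers as a factor of a permutation shift\<close>

lemma M_eq: "bernoulli_measure f = Pi\<^sub>M UNIV (\<lambda>i. density L (\<lambda>u. ennreal (f i u)))"
  by (simp add: bernoulli_measure_def L_def)

lemma sets_M: "sets (bernoulli_measure f) = sets (Pi\<^sub>M UNIV (\<lambda>_. L))"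
  unfolding M_eq by (rule sets_PiM_cong) auto

lemma space_M: "space (bernoulli_measure f) = {x. \<forall>i. x i \<in> {0..1}}"
  by (auto simp: M_eq space_PiM)

lemma shift_product_measurable:
  "(\<lambda>x. \<lambda>j\<in>{..<k}. \<lambda>i. x j (i + d j)) \<in> measurable (\<Pi>\<^sub>M j\<in>{..<k}. bernoulli_measure f) (\<Pi>\<^sub>M j\<in>{..<k}. bernoulli_measure f)"
proof (rule measurable_restrict)
  fix j assume j: "j \<in> {..<k}"
  have comp: "(\<lambda>x. x j i) \<in> measurable (\<Pi>\<^sub>M j\<in>{..<k}. bernoulli_measure f) L" for i
  proof (rule measurable_compose[OF measurable_component_singleton[OF j]])
    show "(\<lambda>y. y i) \<in> measurable (bernoulli_measure f) L"
      unfolding measurable_cong_sets[OF sets_M refl] by (rule measurable_component_singleton) simp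
  qed
  show "(\<lambda>x i. x j (i + d j)) \<in> measurable (\<Pi>\<^sub>M j\<in>{..<k}. bernoulli_measure f) (bernoulli_measure f)"
    unfolding measurable_cong_sets[OF refl sets_M]
    by (rule measurable_PiM_single'[OF comp]) (use measurable_space[OF comp] in auto)
qed

lemma ergodic_product:
  assumes k: "1 \<le> k" and n: "\<And>j. j < k \<Longrightarrow> n j \<noteq> 0"
  shows "ergodic (Pi\<^sub>M {..<k} (\<lambda>_. bernoulli_measure f))
    (product_map k (\<lambda>j. int_iterate (space (bernoulli_measure f)) bernoulli_shift (n j)))"
proof -
  \<comment> \<open>The permutation acts on all of \<open>nat \<times> int\<close>. The surplus rows
    \<open>j \<ge> k\<close> carry the constant density 1 and move by 1: they change no density, yet
    their orbits are infinite as \<open>escape\<close> demands. The map \<open>\<pi>\<close> forgets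
    them.\<close>
  define d where "d j = (if j < k then n j else 1)" for j
  have d: "d j \<noteq> 0" for j using n by (simp add: d_def)
  define \<phi> where "\<phi> p = (if fst p < k then f (snd p) else (\<lambda>_. 1))" for p :: "nat \<times> int"
  define \<sigma> \<tau> where "\<sigma> p = (fst p, snd p + d (fst p))" and "\<tau> p = (fst p, snd p - d (fst p))" for p :: "nat \<times> int"
  define e where "e = from_nat_into (UNIV :: (nat \<times> int) set)"
  have bij_e: "bij e"
    unfolding e_def by (intro bij_betw_from_nat_into) (simp_all add: finite_prod)
  have \<phi>_meas: "\<phi> p \<in> borel_measurable L" for p by (simp add: \<phi>_def f_meas)
  have \<phi>_int: "(\<integral>\<^sup>+u. ennreal (\<phi> p u) \<partial>L) = 1" for p
    using L.emeasure_space_1 by (simp add: \<phi>_def f_int)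
  have \<phi>_lo: "lam \<le> \<phi> p u" and \<phi>_hi: "\<phi> p u \<le> inverse lam" if "u \<in> space L" for p u
    using that lam f_bounds[of u] by (auto simp: \<phi>_def one_le_inverse)
  interpret density_family L \<phi> e lam "inverse lam"
    by unfold_locales (rule \<phi>_meas lam(1) \<phi>_lo \<phi>_hi \<phi>_int bij_e; assumption?)+
  define D where "D N = (\<Sum>j<k. 2 * (1 + lam) * (\<Sum>l<nat \<bar>int N * d j\<bar>. mass l))" for N
  have c: "0 < (inverse lam)\<^sup>2 / lam" using lam by simp
  obtain K where K: "\<And>N. exp ((inverse lam)\<^sup>2 / lam * D N) \<le> K * sqrt (real (Suc N))"
    using exp_sum_mass_le_sqrt[OF c, where k = k and d = d] unfolding D_def by blast
  have \<sigma>_pow: "(\<sigma> ^^ N) p = (fst p, snd p + int N * d (fst p))" for N p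
    by (induction N) (simp_all add: \<sigma>_def algebra_simps)
  have \<tau>_pow: "(\<tau> ^^ N) p = (fst p, snd p - int N * d (fst p))" for N p
    by (induction N) (simp_all add: \<tau>_def algebra_simps)
  interpret permutation_shift L \<phi> e lam "inverse lam" \<sigma> \<tau> D K
  proof unfold_locales
    show "\<sigma> (\<tau> p) = p" "\<tau> (\<sigma> p) = p" for p by (simp_all add: \<sigma>_def \<tau>_def)
    show "exp ((inverse lam)\<^sup>2 / lam * D N) \<le> K * sqrt (real (Suc N))" for N by (rule K)
    show "(\<Sum>p\<in>F. dist_mass (\<tau> ^^ N) p) \<le> D N" if F: "finite F" for N F
    proof -
      have dm: "dist_mass (\<tau> ^^ N) (j, i) = (if j < k then change (int N * d j) i else 0)" for j i
        by (simp add: dist_mass_def change_def \<phi>_def \<tau>_pow)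
      have nonneg: "0 \<le> dist_mass (\<tau> ^^ N) p" for p by (simp add: dist_mass_def)
      \<comment> \<open>A rectangle around \<open>F\<close> allows summation row by row; the rows
        beyond \<open>k\<close> contribute 0.\<close>
      have "(\<Sum>p\<in>F. dist_mass (\<tau> ^^ N) p) \<le> (\<Sum>p\<in>(fst ` F \<union> {..<k}) \<times> snd ` F. dist_mass (\<tau> ^^ N) p)"
        using F nonneg by (intro sum_mono2) (auto intro: rev_image_eqI)
      also have "\<dots> = (\<Sum>j\<in>fst ` F \<union> {..<k}. \<Sum>i\<in>snd ` F. dist_mass (\<tau> ^^ N) (j, i))"
        by (simp add: sum.cartesian_product)
      also have "\<dots> = (\<Sum>j<k. \<Sum>i\<in>snd ` F. dist_mass (\<tau> ^^ N) (j, i))"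
        using F by (intro sum.mono_neutral_right) (auto simp: dm)
      also have "\<dots> = (\<Sum>j<k. \<Sum>i\<in>snd ` F. change (int N * d j) i)"
        by (simp add: dm)
      also have "\<dots> \<le> D N"
        unfolding D_def using F by (intro sum_mono sum_change_bound) simp
      finally show ?thesis .
    qed
    show "\<forall>\<^sub>F N in sequentially. (\<sigma> ^^ N) p \<noteq> q" for p q
    proof -
      have "(\<sigma> ^^ N) p \<noteq> q" if N: "nat \<bar>snd q - snd p\<bar> + 1 \<le> N" for N
      proof
        assume "(\<sigma> ^^ N) p = q"
        then have "snd q - snd p = int N * d (fst p)" by (auto simp: \<sigma>_pow)
        then have "\<bar>snd q - snd p\<bar> = int N * \<bar>d (fst p)\<bar>" by (simp add: abs_mult)
        moreover have "int N * 1 \<le> int N * \<bar>d (fst p)\<bar>" using d[of "fst p"] by (intro mult_left_mono) auto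
        ultimately show False using N by linarith
      qed
      then show ?thesis unfolding eventually_sequentially by blast
    qed
    show "AE u in L. \<forall>\<^sub>F N in sequentially. \<phi> ((\<tau> ^^ N) p) u = 1" for p
    proof (cases "fst p < k")
      case True
      show ?thesis using AE_eventually_f_eq_1 AE_space
      proof eventually_elim
        case (elim u)
        \<comment> \<open>\<open>\<tau>\<close> moves against \<open>\<sigma>\<close>, hence the
          sign of the step. A positive step meets the shrinking intervals, a negative one the
          indices at most 1.\<close>
        have "\<forall>\<^sub>F N in sequentially. f (snd p + int N * (- d (fst p))) u = 1"
          by (rule eventually_of_int_multiple) (use d elim f_le_1 in auto)
        then show ?case using True by (simp add: \<phi>_def \<tau>_pow)
      qed
    qed (simp add: \<phi>_def \<tau>_pow)
  qed
  let ?M = "bernoulli_measure f"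
  let ?N = "Pi\<^sub>M {..<k} (\<lambda>_. ?M)"
  let ?\<Omega> = "{x :: int \<Rightarrow> real. \<forall>i. x i \<in> {0..1}}"
  let ?R = "product_map k (\<lambda>j. int_iterate (space ?M) bernoulli_shift (n j))"
  define \<pi> where "\<pi> y = (\<lambda>j\<in>{..<k}. \<lambda>i. y (j, i))" for y :: "nat \<times> int \<Rightarrow> real"
  have block: "(\<Pi>\<^sub>M i\<in>UNIV. P (j, i)) = ?M" if "j < k" for j
    using that by (simp add: P_def \<phi>_def M_eq)
  have N_eq: "(\<Pi>\<^sub>M j\<in>{..<k}. \<Pi>\<^sub>M i\<in>UNIV. P (j, i)) = ?N"
    by (rule PiM_cong) (simp_all add: block)
  have space_N: "space ?N = {..<k} \<rightarrow>\<^sub>E ?\<Omega>" by (simp add: space_PiM space_M)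
  have \<pi>_meas: "\<pi> \<in> measurable Y ?N"
    unfolding \<pi>_def
  proof (rule measurable_restrict)
    show "(\<lambda>y i. y (j, i)) \<in> measurable Y ?M" for j
      unfolding measurable_cong_sets[OF refl sets_M]
      by (rule measurable_PiM_single'[OF component_Y]) (use measurable_space[OF component_Y] in auto)
  qed
  show ?thesis
  proof (rule ergodic_factor[where Y = Y and S = S and \<pi> = \<pi>])
    show "distr Y ?N \<pi> = ?N"
      using distr_PiM_blocks[of P "{..<k}"] prob_space_P k unfolding N_eq \<pi>_def Y_def by (simp add: lessThan_empty_iff)
    show "\<pi> (S y) = ?R (\<pi> y)" if y: "y \<in> space Y" for y
    proof -
      have "\<pi> y \<in> {..<k} \<rightarrow>\<^sub>E ?\<Omega>" using measurable_space[OF \<pi>_meas y] unfolding space_N .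
      then have "?R (\<pi> y) = (\<lambda>j\<in>{..<k}. \<lambda>i. \<pi> y j (i + n j))"
        unfolding space_M by (rule product_map_shift)
      also have "\<dots> = \<pi> (S y)" by (auto simp: \<pi>_def S_def \<sigma>_def d_def fun_eq_iff)
      finally show ?thesis ..
    qed
    show "emeasure Y (S -` E \<inter> space Y) = 0 \<longleftrightarrow> emeasure Y E = 0" if "E \<in> sets Y" for E
      using that by (rule emeasure_vimage_eq_0_iff)
    show "emeasure Y E = 0 \<or> emeasure Y (space Y - E) = 0"
      if "E \<in> sets Y" "AE y in Y. S y \<in> E \<longleftrightarrow> y \<in> E" for E
      using that by (rule invariant_trivial)
    show "bij_betw ?R (space ?N) (space ?N)"
      unfolding space_N space_M by (rule product_map_shift_bij)
    show "?R \<in> measurable ?N ?N"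
      by (rule measurable_cong[THEN iffD2, OF _ shift_product_measurable[where d = n]])
         (unfold space_N space_M, rule product_map_shift)
    show "the_inv_into (space ?N) ?R \<in> measurable ?N ?N"
    proof (rule measurable_cong[THEN iffD2, OF _ shift_product_measurable[where d = "\<lambda>j. - n j"]])
      fix x assume "x \<in> space ?N"
      then have "the_inv_into (space ?N) ?R x = (\<lambda>j\<in>{..<k}. \<lambda>i. x j (i - n j))"
        unfolding space_N space_M by (rule product_map_shift_bij)
      then show "the_inv_into (space ?N) ?R x = (\<lambda>j\<in>{..<k}. \<lambda>i. x j (i + - n j))" by simp
    qed
  qed (rule S_meas \<pi>_meas)+
qed

end

theorem corollary35:
  fixes lam :: real
    and a :: "int \<Rightarrow> real"
    and A B :: "int \<Rightarrow> real set"
    and f :: "int \<Rightarrow> real \<Rightarrow> real"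
  assumes lam: "0 < lam" "lam < 1"
    and a: "\<And>n. 2 \<le> n \<Longrightarrow> a n = 1 / ((real_of_int n + 4) * ln (real_of_int n + 4))"
    and A: "\<And>n. 2 \<le> n \<Longrightarrow> is_interval (A n) \<and> openin (top_of_set {0..1}) (A n)"
    and B: "\<And>n. 2 \<le> n \<Longrightarrow> is_interval (B n) \<and> openin (top_of_set {0..1}) (B n)"
    and disjoint: "\<And>n. 2 \<le> n \<Longrightarrow> A n \<inter> B n = {}"
    and A_nested: "\<And>n. 2 \<le> n \<Longrightarrow> A (n + 1) \<subseteq> A n"
    and B_nested: "\<And>n. 2 \<le> n \<Longrightarrow> B (n + 1) \<subseteq> B n"
    and A_length: "\<And>n. 2 \<le> n \<Longrightarrow> measure lborel (A n) = a n"
    and B_length: "\<And>n. 2 \<le> n \<Longrightarrow> a n = inverse lam * measure lborel (B n)"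
    and f_le_1: "\<And>n u. n \<le> 1 \<Longrightarrow> u \<in> {0..1} \<Longrightarrow> f n u = 1"
    and f_A: "\<And>n u. 2 \<le> n \<Longrightarrow> u \<in> A n \<Longrightarrow> f n u = lam"
    and f_B: "\<And>n u. 2 \<le> n \<Longrightarrow> u \<in> B n \<Longrightarrow> f n u = inverse lam"
    and f_else: "\<And>n u. 2 \<le> n \<Longrightarrow> u \<in> {0..1} - (A n \<union> B n) \<Longrightarrow> f n u = 1"
  shows "power_weakly_mixing (bernoulli_measure f) bernoulli_shift"
proof -
  \<comment> \<open>Openness is relative to [0,1], so the intervals may contain an endpoint; being
    traces of open sets, they are still Borel.\<close>
  have relopen: "X \<in> sets borel \<and> X \<subseteq> {0..1}" if "openin (top_of_set {0..1}) X" for X :: "real set"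
    using that by (auto simp: openin_open)
  have a_mass: "a (int l + 2) = mass l" for l
    using a[of "int l + 2"] by (simp add: mass_def add.commute)
  have A': "2 \<le> n \<Longrightarrow> A n \<in> sets borel" "2 \<le> n \<Longrightarrow> A n \<subseteq> {0..1}" for n
    using A[of n] relopen[of "A n"] by simp_all
  have B': "2 \<le> n \<Longrightarrow> B n \<in> sets borel" "2 \<le> n \<Longrightarrow> B n \<subseteq> {0..1}" for n
    using B[of n] relopen[of "B n"] by simp_all
  interpret nested_bumps lam A B f
  proof unfold_locales
    show "measure lborel (A (int l + 2)) = mass l" for l
      using A_length[of "int l + 2"] a_mass by simp
    show "measure lborel (B (int l + 2)) = lam * mass l" for l
      using B_length[of "int l + 2"] a_mass[of l] lam by (simp add: field_simps)
  qed (rule lam A' B' disjoint A_nested B_nested f_le_1 f_A f_B f_else; assumption)+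
  show ?thesis
    unfolding power_weakly_mixing_def using ergodic_product by blast
qed

end
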